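(* Let $d\in\mathbb N$. If $d$ is odd, then $\mathbb C_{\mathrm{stable}}[z]\subseteq\mathcal C_{\frac{d-1}{2}}(H^2_d)$. If $d$ is even, then $\mathbb C_{\mathrm{stable}}[z]\subseteq\mathcal C_{\frac d2-1}(H^2_d)$.
   Context: $\mathbb B_d$ is the open unit ball of $\mathbb C^d$. The Drury-Arveson space $H^2_d$ is the Hilbert space of analytic functions $f(z)=\sum_{\alpha\in\mathbb N_0^d}\hat f(\alpha)z^\alpha$ on $\mathbb B_d$ with $\|f\|^2_{H^2_d}=\sum_{\alpha\in\mathbb N_0^d}\frac{\alpha!}{|\alpha|!}|\hat f(\alpha)|^2<\infty$. $\mathbb C_{\mathrm{stable}}[z]$ is the set of $d$-variable complex polynomials with no zeros in $\mathbb B_d$. $\mathrm{Mult}(H^2_d)=\{\varphi:\varphi f\in H^2_d\text{ for all }f\in H^2_d\}$; for $f\in H^2_d$, $[f]$ is the closure in $H^2_d$ of $\{\varphi f:\varphi\in\mathrm{Mult}(H^2_d)\}$; for integers $n\ge0$, $\mathcal C_n(H^2_d)=\{\varphi\in\mathrm{Mult}(H^2_d):\varphi\ne0,\ [\varphi^n]=[\varphi^{n+1}]\}$, with $\varphi^0=1$. *)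

theory Defs
  imports "HOL-Analysis.Analysis"
begin

text \<open>
  The dimension is \<open>d = CARD('d) \<ge> 1\<close>, and \<open>ball 0 1 :: (complex ^ 'd) set\<close> is the open Euclidean unit
  ball of \<open>d\<close>-dimensional complex space. Multi-indices are functions \<open>'d \<Rightarrow> nat\<close>.

  A function on the ball is represented by a total function whose values off the ball are ignored:
  every set of functions below except \<open>stable_polys\<close> is invariant under changing its members off
  the ball, so that equality of two such sets is equality of the sets of functions on the ball.
\<close>

definition mi_power :: "complex ^ 'd \<Rightarrow> ('d::finite \<Rightarrow> nat) \<Rightarrow> complex" where
  "mi_power z \<alpha> = (\<Prod>i\<in>UNIV. (z $ i) ^ \<alpha> i)"

definition mi_fact :: "('d::finite \<Rightarrow> nat) \<Rightarrow> nat" where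
  "mi_fact \<alpha> = (\<Prod>i\<in>UNIV. fact (\<alpha> i))"

definition mi_size :: "('d::finite \<Rightarrow> nat) \<Rightarrow> nat" where
  "mi_size \<alpha> = (\<Sum>i\<in>UNIV. \<alpha> i)"

text \<open>
  The unit ball is a complete Reinhardt domain, so a function is analytic on it iff it is the sum of
  a power series converging (unconditionally, i.e. absolutely) at every point of the ball.
\<close>

definition has_power_series ::
  "(complex ^ 'd \<Rightarrow> complex) \<Rightarrow> (('d::finite \<Rightarrow> nat) \<Rightarrow> complex) \<Rightarrow> bool" where
  "has_power_series f c \<longleftrightarrow>
     (\<forall>z\<in>ball 0 1. ((\<lambda>\<alpha>. c \<alpha> * mi_power z \<alpha>) has_sum f z) UNIV)"

definition analytic_ball :: "(complex ^ 'd::finite \<Rightarrow> complex) \<Rightarrow> bool" where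
  "analytic_ball f \<longleftrightarrow> (\<exists>c. has_power_series f c)"

text \<open>The coefficients of an analytic function are unique, so the choice below is harmless.\<close>

definition taylor_coeff ::
  "(complex ^ 'd \<Rightarrow> complex) \<Rightarrow> ('d::finite \<Rightarrow> nat) \<Rightarrow> complex" where
  "taylor_coeff f = (SOME c. has_power_series f c)"

definition H2_term :: "(complex ^ 'd \<Rightarrow> complex) \<Rightarrow> ('d::finite \<Rightarrow> nat) \<Rightarrow> real" where
  "H2_term f \<alpha> = real (mi_fact \<alpha>) / fact (mi_size \<alpha>) * (cmod (taylor_coeff f \<alpha>))\<^sup>2"

definition H2 :: "(complex ^ 'd::finite \<Rightarrow> complex) set" where
  "H2 = {f. analytic_ball f \<and> H2_term f summable_on UNIV}"

definition H2_norm :: "(complex ^ 'd::finite \<Rightarrow> complex) \<Rightarrow> real" where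
  "H2_norm f = sqrt (\<Sum>\<^sub>\<infinity>\<alpha>. H2_term f \<alpha>)"

definition H2_closure ::
  "(complex ^ 'd::finite \<Rightarrow> complex) set \<Rightarrow> (complex ^ 'd \<Rightarrow> complex) set" where
  "H2_closure S = {g \<in> H2. \<forall>\<epsilon>>0. \<exists>h\<in>S. H2_norm (\<lambda>z. g z - h z) < \<epsilon>}"

definition Mult_H2 :: "(complex ^ 'd::finite \<Rightarrow> complex) set" where
  "Mult_H2 = {\<phi>. \<forall>f\<in>H2. (\<lambda>z. \<phi> z * f z) \<in> H2}"

definition cyclic_subspace ::
  "(complex ^ 'd::finite \<Rightarrow> complex) \<Rightarrow> (complex ^ 'd \<Rightarrow> complex) set" where
  "cyclic_subspace f = H2_closure {\<lambda>z. \<phi> z * f z | \<phi>. \<phi> \<in> Mult_H2}"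

definition C_class :: "nat \<Rightarrow> (complex ^ 'd::finite \<Rightarrow> complex) set" where
  "C_class n = {\<phi> \<in> Mult_H2. (\<exists>z\<in>ball 0 1. \<phi> z \<noteq> 0) \<and>
     cyclic_subspace (\<lambda>z. \<phi> z ^ n) = cyclic_subspace (\<lambda>z. \<phi> z ^ (n + 1))}"

text \<open>Complex polynomials are identified with the polynomial functions they induce.\<close>

definition stable_polys :: "(complex ^ 'd::finite \<Rightarrow> complex) set" where
  "stable_polys = {p. (\<exists>A c. finite A \<and> p = (\<lambda>z. \<Sum>\<alpha>\<in>A. c \<alpha> * mi_power z \<alpha>)) \<and>
     (\<forall>z\<in>ball 0 1. p z \<noteq> 0)}"

end

theory Submission
  imports Defs "HOL-Real_Asymp.Real_Asymp" "HOL-Computational_Algebra.Polynomial_FPS"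
    "HOL-Computational_Algebra.Fundamental_Theorem_Algebra"
begin

text \<open>
  In both cases the exponent is \<open>n = (d - 1) div 2\<close>, the least \<open>n\<close> with \<open>d \<le> 2 n + 2\<close>. The heart of the matter is that
  \<open>p\<^sup>n\<close> is a limit in \<open>H\<^sup>2\<^sub>d\<close> of functions \<open>q p\<^sup>n\<^sup>+\<^sup>1\<close> with polynomials \<open>q\<close> (\<open>stable_power_approx\<close>). The natural candidates
  for \<open>q\<close> are Taylor polynomials of \<open>1 / p\<^sub>r\<close>, where \<open>p\<^sub>r(z) = p(r z)\<close> and \<open>r < 1\<close> tends to \<open>1\<close>. The coefficients
  of \<open>q p\<^sup>n\<^sup>+\<^sup>1\<close> then converge to those of \<open>p\<^sup>n\<close>. Hence it is enough that the norms stay bounded, for then suitable means converge in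
  norm (\<open>banach_saks_polyfun\<close>).

  Boundedness is a question about one variable. On the line through a unit vector \<open>\<zeta>\<close> the polynomial factors as
  \<open>p(\<lambda> \<zeta>) = p(0) \<Prod>\<^sub>j (1 - b\<^sub>j \<lambda>)\<close> with \<open>\<bar>b\<^sub>j\<bar> \<le> 1\<close>, because \<open>p\<close> has no zeros in the ball. So \<open>p\<^sup>n\<^sup>+\<^sup>1 / p\<^sub>r\<close>
  is, up to the constant \<open>p(0)\<^sup>n\<close>, the product of the series \<open>u = (1 - b\<^sub>j \<lambda>)\<^sup>n\<^sup>+\<^sup>1 / (1 - r b\<^sub>j \<lambda>)\<close>. From index \<open>n + 1\<close> on,
  the coefficients of \<open>u\<close> are bounded by \<open>(1 - r)\<^sup>n\<^sup>+\<^sup>1 r\<^sup>k\<^sup>-\<^sup>n\<^sup>-\<^sup>1\<close>. Therefore both \<open>\<Sum>\<^sub>k \<bar>u\<^sub>k\<bar>\<close> and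
  \<open>\<Sum>\<^sub>k (k + 1)\<^sup>d\<^sup>-\<^sup>1 \<bar>u\<^sub>k\<bar>\<^sup>2\<close> are bounded uniformly in \<open>r\<close> and \<open>b\<^sub>j\<close>, the latter since \<open>d \<le> 2 n + 2\<close>
  (\<open>quot_factor_l2\<close>), and this pair of bounds is inherited by products (\<open>l2_bounded_mult\<close>).

  The passage back to \<open>d\<close> variables is \<open>sphere_norm_bound\<close>: if the homogeneous parts of a polynomial \<open>f\<close> satisfy
  \<open>\<Sum>\<^sub>k (k + 1)\<^sup>d\<^sup>-\<^sup>1 \<bar>f\<^sub>k(\<zeta>)\<bar>\<^sup>2 \<le> C\<close> at all unit vectors, then the squared norm of \<open>f\<close> in \<open>H\<^sup>2\<^sub>d\<close> is at most \<open>C\<close>. This is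
  integration over the sphere, carried out with finite means only: over roots of unity for the phases, and over grids on the
  simplex for the moduli of the coordinates.
\<close>

section \<open>Counting multi-indices\<close>

text \<open>
  Both sides count the \<open>(p + q + 1)\<close>-subsets of \<open>{0..N}\<close>: the summand with index \<open>a\<close> counts those whose
  element number \<open>p + 1\<close>, in increasing order, is \<open>a\<close>.
\<close>

lemma sum_choose_convolve:
  "(\<Sum>a\<le>N. (a choose p) * ((N - a) choose q)) = Suc N choose (p + q + 1)"
proof (induction N arbitrary: q)
  case 0
  show ?case by (cases p; cases q) auto
next
  case (Suc N)
  show ?case
  proof (cases q)
    case 0
    show ?thesis using sum_choose_upper[of p "Suc N"] 0 by simp
  next
    case (Suc q')
    have "(\<Sum>a\<le>Suc N. (a choose p) * ((Suc N - a) choose q))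
        = (\<Sum>a\<le>N. (a choose p) * (((N - a) choose q') + ((N - a) choose q)))"
      by (simp add: Suc Suc_diff_le)
    also have "\<dots> = (Suc N choose (p + q' + 1)) + (Suc N choose (p + q + 1))"
      unfolding distrib_left sum.distrib Suc.IH ..
    also have "\<dots> = Suc (Suc N) choose (p + q + 1)"
      using Suc by simp
    finally show ?thesis .
  qed
qed

definition indices :: "'d set \<Rightarrow> nat \<Rightarrow> ('d::finite \<Rightarrow> nat) set" where
  "indices I M = {g. (\<forall>i. i \<notin> I \<longrightarrow> g i = 0) \<and> (\<Sum>i\<in>I. g i) = M}"

lemma finite_indices [simp]: "finite (indices I M)"
proof (rule finite_subset)
  show "indices I M \<subseteq> PiE UNIV (\<lambda>_. {..M})"
  proof (auto simp: indices_def)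
    fix g :: "'a \<Rightarrow> nat" and i assume "\<forall>i. i \<notin> I \<longrightarrow> g i = 0" "M = sum g I"
    then show "g i \<le> sum g I" by (cases "i \<in> I") (auto intro: member_le_sum)
  qed
qed (auto intro: finite_PiE)

lemma sum_indices_insert:
  fixes f :: "('d::finite \<Rightarrow> nat) \<Rightarrow> 'c::comm_monoid_add"
  assumes "j \<notin> I"
  shows "(\<Sum>g\<in>indices (insert j I) M. f g) = (\<Sum>a\<le>M. \<Sum>g\<in>indices I (M - a). f (g(j := a)))"
proof -
  have *: "(\<Sum>i\<in>I. if i = j then x else g i) = sum g I" for g :: "'d \<Rightarrow> nat" and x
    by (rule sum.cong) (use assms in auto)
  have "(\<Sum>a\<le>M. \<Sum>g\<in>indices I (M - a). f (g(j := a)))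
      = (\<Sum>(a,g)\<in>Sigma {..M} (\<lambda>a. indices I (M - a)). f (g(j := a)))"
    by (rule sum.Sigma) auto
  also have "\<dots> = (\<Sum>g\<in>indices (insert j I) M. f g)"
    by (rule sum.reindex_bij_witness[where j = "\<lambda>(a,g). g(j := a)" and i = "\<lambda>g. (g j, g(j := 0))"])
      (use assms in \<open>auto simp: indices_def fun_upd_idem_iff *\<close>)
  finally show ?thesis by simp
qed

text \<open>
  A discrete Dirichlet integral. For large \<open>M\<close> the points \<open>g / M\<close> are equidistributed in the simplex and the
  binomial coefficients approximate monomials, so that the identity turns into the formula for the moments
  of the uniform measure on the simplex, that is, of the numbers \<open>\<bar>z\<^sub>i\<bar>\<^sup>2\<close> for a random point \<open>z\<close> of the unit sphere.
\<close>

lemma sum_indices_choose: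
  fixes \<alpha> :: "'d::finite \<Rightarrow> nat"
  assumes "I \<noteq> {}"
  shows "(\<Sum>g\<in>indices I M. \<Prod>i\<in>I. (g i choose \<alpha> i)) = (M + card I - 1) choose ((\<Sum>i\<in>I. \<alpha> i) + card I - 1)"
proof -
  have "finite I" by simp
  then show ?thesis using assms
  proof (induction I arbitrary: M rule: finite_ne_induct)
    case (singleton j)
    have "indices {j} M = {(\<lambda>_. 0)(j := M)}"
      by (auto simp: indices_def)
    then show ?case by simp
  next
    case (insert j I)
    have c: "card I > 0" using insert by (simp add: card_gt_0_iff)
    let ?s = "\<Sum>i\<in>I. \<alpha> i"
    let ?N = "M + card I - 1"
    have *: "(\<Prod>i\<in>insert j I. ((g(j := a)) i choose \<alpha> i)) = (a choose \<alpha> j) * (\<Prod>i\<in>I. (g i choose \<alpha> i))" for g a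
    proof -
      have "(\<Prod>i\<in>I. ((g(j := a)) i choose \<alpha> i)) = (\<Prod>i\<in>I. (g i choose \<alpha> i))"
        by (rule prod.cong) (use insert in auto)
      then show ?thesis using insert by simp
    qed
    have "(\<Sum>g\<in>indices (insert j I) M. \<Prod>i\<in>insert j I. (g i choose \<alpha> i))
        = (\<Sum>a\<le>M. (a choose \<alpha> j) * ((M - a + card I - 1) choose (?s + card I - 1)))"
      unfolding sum_indices_insert[OF insert.hyps(3)] * by (simp flip: sum_distrib_left add: insert.IH)
    also have "\<dots> = (\<Sum>a\<le>M. (a choose \<alpha> j) * ((?N - a) choose (?s + card I - 1)))"
      by (rule sum.cong) (use c in \<open>auto simp: algebra_simps\<close>)
    also have "\<dots> = (\<Sum>a\<le>?N. (a choose \<alpha> j) * ((?N - a) choose (?s + card I - 1)))"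
    proof (rule sum.mono_neutral_left)
      show "\<forall>a\<in>{..?N} - {..M}. (a choose \<alpha> j) * ((?N - a) choose (?s + card I - 1)) = 0"
        using c by (auto intro!: binomial_eq_0)
    qed (use c in auto)
    also have "\<dots> = Suc ?N choose (\<alpha> j + (?s + card I - 1) + 1)"
      by (rule sum_choose_convolve)
    also have "\<dots> = (M + card (insert j I) - 1) choose ((\<Sum>i\<in>insert j I. \<alpha> i) + card (insert j I) - 1)"
      using insert c by (simp add: algebra_simps)
    finally show ?case .
  qed
qed

abbreviation degree_set :: "nat \<Rightarrow> ('d::finite \<Rightarrow> nat) set" where
  "degree_set k \<equiv> {\<alpha>. mi_size \<alpha> = k}"

lemma degree_set_eq: "degree_set k = indices UNIV k"
  by (auto simp: indices_def mi_size_def)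

lemma finite_degree_set [simp]: "finite (degree_set k)"
  by (simp add: degree_set_eq)

lemma index_le_size: "\<alpha> i \<le> mi_size \<alpha>"
  unfolding mi_size_def by (rule member_le_sum) auto

section \<open>Averaging over the torus and over the simplex\<close>

lemma mi_power_mult: "mi_power z (\<lambda>i. \<alpha> i + \<beta> i) = mi_power z \<alpha> * mi_power z \<beta>"
  by (simp add: mi_power_def power_add prod.distrib)

lemma mi_power_scale: "mi_power (x *s z) \<alpha> = x ^ mi_size \<alpha> * mi_power z \<alpha>"
  by (simp add: mi_power_def mi_size_def power_mult_distrib prod.distrib power_sum)

lemma root_of_unity_orthogonality:
  assumes "a < N" "b < N"
  defines "w \<equiv> cis (2 * pi / N)"
  shows "(\<Sum>g<N. (w ^ g) ^ a * cnj ((w ^ g) ^ b)) = (if a = b then of_nat N else 0)"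
proof -
  let ?q = "cis (2 * pi * (real a - real b) / N)"
  have N: "N > 0" using assms by simp
  have summand: "(w ^ g) ^ a * cnj ((w ^ g) ^ b) = ?q ^ g" for g
  proof -
    have "(w ^ g) ^ k = (w ^ k) ^ g" for k
      by (metis power_mult mult.commute)
    then have "(w ^ g) ^ a * cnj ((w ^ g) ^ b) = (w ^ a * cnj (w ^ b)) ^ g"
      by (simp add: power_mult_distrib)
    also have "w ^ a * cnj (w ^ b) = cis (real a * (2 * pi / real N) + - (real b * (2 * pi / real N)))"
      by (simp only: w_def Complex.DeMoivre cis_cnj cis_mult)
    also have "real a * (2 * pi / real N) + - (real b * (2 * pi / real N)) = 2 * pi * (real a - real b) / N"
      by (simp add: algebra_simps diff_divide_distrib)
    finally show ?thesis .
  qed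
  show ?thesis
  proof (cases "a = b")
    case True
    then show ?thesis unfolding summand by simp
  next
    case False
    have "?q \<noteq> 1"
    proof
      assume "?q = 1"
      then have "cos (2 * pi * (real a - real b) / N) = 1" by (metis cis.sel(1) one_complex.sel(1))
      then obtain k :: int where "2 * pi * (real a - real b) / N = k * 2 * pi"
        unfolding cos_one_2pi_int by auto
      then have "(2 * pi) * (real a - real b) = (2 * pi) * (k * real N)" using N by (simp add: field_simps)
      then have "real a - real b = k * real N" unfolding mult_cancel_left by simp
      then have *: "int a - int b = k * int N"
        by (metis (mono_tags, opaque_lifting) of_int_diff of_int_eq_iff of_int_mult of_int_of_nat_eq)
      then have "\<bar>k * int N\<bar> < int N" using assms by linarith
      then have "\<bar>k\<bar> * int N < 1 * int N" by (simp add: abs_mult)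
      then have "k = 0" using N by (simp add: mult_less_cancel_right_pos)
      then show False using * False by simp
    qed
    moreover have "?q ^ N = 1"
    proof -
      have "?q ^ N = cis (2 * pi * (real a - real b))"
        using N by (simp add: Complex.DeMoivre)
      moreover have "real a - real b \<in> \<int>" by simp
      ultimately show ?thesis using cis_multiple_2pi by simp
    qed
    ultimately show ?thesis unfolding summand using False by (simp add: sum_gp_strict)
  qed
qed

text \<open>
  Below the exponent \<open>N\<close> the \<open>N\<close>-th roots of unity separate monomials as well as the whole circle does. A finite
  mean therefore replaces the integral over the torus.
\<close>

lemma torus_parseval:
  fixes c :: "('d::finite \<Rightarrow> nat) \<Rightarrow> complex" and t :: "'d \<Rightarrow> real"
  assumes "finite A" and N: "\<And>\<alpha> i. \<alpha> \<in> A \<Longrightarrow> \<alpha> i < N"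
  defines "w \<equiv> cis (2 * pi / N)"
  shows "(\<Sum>g\<in>PiE UNIV (\<lambda>_. {..<N}). (cmod (\<Sum>\<alpha>\<in>A. c \<alpha> * mi_power (\<chi> i. of_real (t i) * w ^ g i) \<alpha>))\<^sup>2)
    = real N ^ CARD('d) * (\<Sum>\<alpha>\<in>A. (cmod (c \<alpha>))\<^sup>2 * (\<Prod>i\<in>UNIV. t i ^ (2 * \<alpha> i)))"
proof -
  let ?G = "PiE UNIV (\<lambda>_::'d. {..<N})"
  let ?z = "\<lambda>g. (\<chi> i. of_real (t i) * w ^ g i) :: complex ^ 'd"
  have orth: "(\<Sum>g\<in>?G. mi_power (?z g) \<alpha> * cnj (mi_power (?z g) \<beta>))
      = (if \<alpha> = \<beta> then of_real (real N ^ CARD('d) * (\<Prod>i\<in>UNIV. t i ^ (2 * \<alpha> i))) else 0)"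
    if "\<alpha> \<in> A" "\<beta> \<in> A" for \<alpha> \<beta>
  proof -
    have "(\<Sum>g\<in>?G. mi_power (?z g) \<alpha> * cnj (mi_power (?z g) \<beta>))
        = (\<Sum>g\<in>?G. \<Prod>i\<in>UNIV. of_real (t i ^ (\<alpha> i + \<beta> i)) * ((w ^ g i) ^ \<alpha> i * cnj ((w ^ g i) ^ \<beta> i)))"
      by (simp add: mi_power_def prod.distrib power_mult_distrib power_add mult_ac)
    also have "\<dots> = (\<Prod>i\<in>UNIV. \<Sum>a<N. of_real (t i ^ (\<alpha> i + \<beta> i)) * ((w ^ a) ^ \<alpha> i * cnj ((w ^ a) ^ \<beta> i)))"
      by (rule prod_sum_PiE[symmetric]) auto
    also have "\<dots> = (\<Prod>i\<in>UNIV. of_real (t i ^ (\<alpha> i + \<beta> i)) * (if \<alpha> i = \<beta> i then of_nat N else 0))"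
      unfolding sum_distrib_left[symmetric] w_def
      using that N by (simp only: root_of_unity_orthogonality)
    also have "\<dots> = (if \<alpha> = \<beta> then of_real (real N ^ CARD('d) * (\<Prod>i\<in>UNIV. t i ^ (2 * \<alpha> i))) else 0)"
    proof (cases "\<alpha> = \<beta>")
      case True
      then show ?thesis by (simp add: prod.distrib mult.commute flip: mult_2_right)
    next
      case False
      then obtain i where "\<alpha> i \<noteq> \<beta> i" by auto
      then show ?thesis using False by (auto intro: prod_zero)
    qed
    finally show ?thesis .
  qed
  have "complex_of_real (\<Sum>g\<in>?G. (cmod (\<Sum>\<alpha>\<in>A. c \<alpha> * mi_power (?z g) \<alpha>))\<^sup>2)
      = (\<Sum>g\<in>?G. (\<Sum>\<alpha>\<in>A. c \<alpha> * mi_power (?z g) \<alpha>) * cnj (\<Sum>\<alpha>\<in>A. c \<alpha> * mi_power (?z g) \<alpha>))"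
    by (simp only: complex_norm_square of_real_sum)
  also have "\<dots> = (\<Sum>g\<in>?G. \<Sum>\<alpha>\<in>A. \<Sum>\<beta>\<in>A. c \<alpha> * cnj (c \<beta>) * (mi_power (?z g) \<alpha> * cnj (mi_power (?z g) \<beta>)))"
    by (simp add: sum_product mult_ac)
  also have "\<dots> = (\<Sum>\<alpha>\<in>A. \<Sum>\<beta>\<in>A. c \<alpha> * cnj (c \<beta>) * (\<Sum>g\<in>?G. mi_power (?z g) \<alpha> * cnj (mi_power (?z g) \<beta>)))"
    unfolding sum_distrib_left
    by (subst sum.swap) (simp add: sum.swap[of _ ?G])
  also have "\<dots> = (\<Sum>\<alpha>\<in>A. \<Sum>\<beta>\<in>A. if \<beta> = \<alpha> then of_real ((cmod (c \<alpha>))\<^sup>2 * (real N ^ CARD('d) * (\<Prod>i\<in>UNIV. t i ^ (2 * \<alpha> i)))) else 0)"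
    by (intro sum.cong refl) (auto simp: orth complex_norm_square simp del: of_real_power)
  also have "\<dots> = complex_of_real (real N ^ CARD('d) * (\<Sum>\<alpha>\<in>A. (cmod (c \<alpha>))\<^sup>2 * (\<Prod>i\<in>UNIV. t i ^ (2 * \<alpha> i))))"
    using assms(1) by (simp add: sum_distrib_left mult_ac)
  finally show ?thesis by (simp only: of_real_eq_iff)
qed

definition homog_part :: "(('d::finite \<Rightarrow> nat) \<Rightarrow> complex) \<Rightarrow> nat \<Rightarrow> complex ^ 'd \<Rightarrow> complex" where
  "homog_part c k z = (\<Sum>\<alpha>\<in>degree_set k. c \<alpha> * mi_power z \<alpha>)"

lemma homog_part_scale: "homog_part c k (x *s z) = x ^ k * homog_part c k z"
  by (simp add: homog_part_def mi_power_scale sum_distrib_left mult_ac)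

lemma torus_mean_bound:
  fixes c :: "('d::finite \<Rightarrow> nat) \<Rightarrow> complex" and t :: "'d \<Rightarrow> real"
  assumes C: "\<And>z :: complex ^ 'd. norm z = 1 \<Longrightarrow> (\<Sum>k\<le>D. w k * (cmod (homog_part c k z))\<^sup>2) \<le> C"
    and t: "\<And>i. t i \<ge> 0" "(\<Sum>i\<in>UNIV. (t i)\<^sup>2) = 1"
  shows "(\<Sum>k\<le>D. w k * (\<Sum>\<alpha>\<in>degree_set k. (cmod (c \<alpha>))\<^sup>2 * (\<Prod>i\<in>UNIV. t i ^ (2 * \<alpha> i)))) \<le> C"
proof -
  \<comment> \<open>No exponent that occurs in degrees up to \<open>D\<close> reaches \<open>N\<close>.\<close>
  define N where "N = Suc D"
  let ?w = "cis (2 * pi / N)"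
  let ?G = "PiE UNIV (\<lambda>_::'d. {..<N})"
  let ?z = "\<lambda>g. (\<chi> i. of_real (t i) * ?w ^ g i) :: complex ^ 'd"
  have nz: "norm (?z g) = 1" for g
    using t by (simp add: norm_vec_def L2_set_def norm_mult norm_power power_mult_distrib)
  have cardG: "card ?G = N ^ CARD('d)" by (simp add: card_PiE)
  have "real N ^ CARD('d) * (\<Sum>k\<le>D. w k * (\<Sum>\<alpha>\<in>degree_set k. (cmod (c \<alpha>))\<^sup>2 * (\<Prod>i\<in>UNIV. t i ^ (2 * \<alpha> i))))
     = (\<Sum>k\<le>D. w k * (\<Sum>g\<in>?G. (cmod (homog_part c k (?z g)))\<^sup>2))"
    unfolding sum_distrib_left[of "real N ^ CARD('d)"] homog_part_def
  proof (rule sum.cong[OF refl], goal_cases)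
    case (1 k)
    have "\<alpha> i < N" if "\<alpha> \<in> degree_set k" for \<alpha> :: "'d \<Rightarrow> nat" and i
      using index_le_size[of \<alpha> i] that 1 by (simp add: N_def)
    then show ?case by (subst torus_parseval) (auto simp: mult_ac)
  qed
  also have "\<dots> = (\<Sum>g\<in>?G. \<Sum>k\<le>D. w k * (cmod (homog_part c k (?z g)))\<^sup>2)"
    by (subst sum.swap) (simp add: sum_distrib_left)
  also have "\<dots> \<le> real (card ?G) * C"
    by (intro sum_bounded_above C nz)
  finally show ?thesis unfolding cardG by (simp add: N_def)
qed

lemma choose_le_power: "(k + e) choose e \<le> (k + 1) ^ e"
proof (induction e)
  case (Suc e)
  have "Suc e * ((k + Suc e) choose Suc e) = (k + Suc e) * ((k + e) choose e)"
    using Suc_times_binomial_eq[of "k+e" e] by simp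
  also have "\<dots> \<le> (Suc e * (k + 1)) * (k + 1) ^ e"
    by (intro mult_mono Suc.IH) (auto simp: algebra_simps)
  also have "\<dots> = Suc e * (k + 1) ^ Suc e" by (simp only: power_Suc mult.assoc)
  finally have "Suc e * ((k + Suc e) choose Suc e) \<le> Suc e * (k + 1) ^ Suc e" .
  then show ?case unfolding mult_le_cancel1 by blast
qed auto

lemma choose_ratio:
  assumes "k \<le> M"
  shows "((M + e) choose (k + e)) * fact (k + e) * fact (M - k) = ((M + e) choose e) * (fact M * fact e)"
proof -
  have "fact (k + e) * fact (M + e - (k + e)) * ((M + e) choose (k + e)) = fact (M + e)"
    by (rule binomial_fact_lemma) (use assms in simp)
  moreover have "fact e * fact (M + e - e) * ((M + e) choose e) = fact (M + e)"
    by (rule binomial_fact_lemma) simp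
  ultimately show ?thesis by (simp add: mult_ac)
qed

text \<open>
  The error made by using \<open>M (M - 1) \<dots> (M - k + 1)\<close> in place of \<open>M\<^sup>k\<close> disappears as the grid on the simplex is refined.
\<close>

lemma falling_power_ratio_tendsto: "(\<lambda>M. fact M / (fact (M - k) * real M ^ k)) \<longlonglongrightarrow> 1"
proof (induction k)
  case 0
  show ?case by simp
next
  case (Suc k)
  have l: "(\<lambda>M. (real M - real k) / real M) \<longlonglongrightarrow> 1"
    by real_asymp
  have "(\<lambda>M. fact M / (fact (M - k) * real M ^ k) * ((real M - real k) / real M)) \<longlonglongrightarrow> 1"
    using tendsto_mult[OF Suc l] by simp
  moreover have "\<forall>\<^sub>F M in sequentially. fact M / (fact (M - k) * real M ^ k) * ((real M - real k) / real M) = fact M / (fact (M - Suc k) * real M ^ Suc k)"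
    using eventually_gt_at_top[of k]
  proof eventually_elim
    case (elim M)
    then have "M - k = Suc (M - Suc k)" by simp
    then have "fact (M - k) = (real M - real k) * fact (M - Suc k)"
      using elim by (simp add: of_nat_diff)
    moreover have "real M - real k \<noteq> 0" using elim by simp
    ultimately show ?case by simp
  qed
  ultimately show ?case by (rule Lim_transform_eventually)
qed

text \<open>
  Averaging the hypothesis over the unit sphere gives the claim: the mean of \<open>\<bar>z\<^sup>\<alpha>\<bar>\<^sup>2\<close> is
  \<open>\<alpha>! (d - 1)! / (\<bar>\<alpha>\<bar> + d - 1)!\<close>, which is \<open>\<alpha>! / \<bar>\<alpha>\<bar>!\<close> divided by \<open>(k + d - 1) choose (d - 1)\<close> for \<open>k = \<bar>\<alpha>\<bar>\<close>, and that binomial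
  coefficient is at most \<open>(k + 1)\<^sup>d\<^sup>-\<^sup>1\<close>. The mean is taken in two steps, over the phases of the coordinates by
  \<open>torus_mean_bound\<close> and over the points \<open>\<bar>z\<^sub>i\<bar>\<^sup>2 = g\<^sub>i / M\<close> of a grid on the simplex. On a grid only an inequality
  is available, with the factor \<open>R M k\<close> below, and \<open>M \<rightarrow> \<infinity>\<close> removes this factor.
\<close>

lemma sphere_norm_bound:
  fixes c :: "('d::finite \<Rightarrow> nat) \<Rightarrow> complex"
  assumes C: "\<And>z :: complex ^ 'd. norm z = 1 \<Longrightarrow>
      (\<Sum>k\<le>D. real (k + 1) ^ (CARD('d) - 1) * (cmod (homog_part c k z))\<^sup>2) \<le> C"
  shows "(\<Sum>k\<le>D. \<Sum>\<alpha>\<in>degree_set k. real (mi_fact \<alpha>) / fact k * (cmod (c \<alpha>))\<^sup>2) \<le> C"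
proof -
  define e where "e = CARD('d) - 1"
  have d: "CARD('d) = Suc e" by (simp add: e_def)
  let ?w = "\<lambda>k. real (k + 1) ^ e"
  define R where "R M k = fact M / (fact (M - k) * real M ^ k)" for M k :: nat
  have step: "(\<Sum>k\<le>D. \<Sum>\<alpha>\<in>degree_set k. R M k * (real (mi_fact \<alpha>) / fact k * (cmod (c \<alpha>))\<^sup>2)) \<le> C"
    if M: "M > D" for M
  proof -
    let ?t = "\<lambda>g i. sqrt (real (g i) / real M)"
    let ?\<Gamma> = "indices (UNIV :: 'd set) M"
    have "(\<Sum>k\<le>D. ?w k * (\<Sum>\<alpha>\<in>degree_set k. (cmod (c \<alpha>))\<^sup>2 * (\<Prod>i\<in>UNIV. ?t g i ^ (2 * \<alpha> i)))) \<le> C"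
      if "g \<in> ?\<Gamma>" for g
    proof (rule torus_mean_bound)
      have "(\<Sum>i\<in>UNIV. (?t g i)\<^sup>2) = real (\<Sum>i\<in>UNIV. g i) / real M"
        by (simp add: sum_divide_distrib)
      also have "(\<Sum>i\<in>UNIV. g i) = M" using that by (simp add: indices_def)
      finally show "(\<Sum>i\<in>UNIV. (?t g i)\<^sup>2) = 1" using M by simp
    qed (use C in \<open>auto simp: e_def\<close>)
    then have "(\<Sum>g\<in>?\<Gamma>. \<Sum>k\<le>D. ?w k * (\<Sum>\<alpha>\<in>degree_set k. (cmod (c \<alpha>))\<^sup>2 * (\<Prod>i\<in>UNIV. ?t g i ^ (2 * \<alpha> i))))
        \<le> real (card ?\<Gamma>) * C"
      by (rule sum_bounded_above)
    also have "card ?\<Gamma> = (M + e) choose e"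
      using sum_indices_choose[of "UNIV :: 'd set" "\<lambda>_. 0" M] by (simp add: d)
    also have "(\<Sum>g\<in>?\<Gamma>. \<Sum>k\<le>D. ?w k * (\<Sum>\<alpha>\<in>degree_set k. (cmod (c \<alpha>))\<^sup>2 * (\<Prod>i\<in>UNIV. ?t g i ^ (2 * \<alpha> i))))
       = (\<Sum>k\<le>D. \<Sum>\<alpha>\<in>degree_set k. ?w k * (cmod (c \<alpha>))\<^sup>2 * (\<Sum>g\<in>?\<Gamma>. \<Prod>i\<in>UNIV. ?t g i ^ (2 * \<alpha> i)))"
      unfolding sum_distrib_left by (subst sum.swap, rule sum.cong[OF refl], subst sum.swap) (simp add: mult_ac)
    finally have main: "(\<Sum>k\<le>D. \<Sum>\<alpha>\<in>degree_set k. ?w k * (cmod (c \<alpha>))\<^sup>2 * (\<Sum>g\<in>?\<Gamma>. \<Prod>i\<in>UNIV. ?t g i ^ (2 * \<alpha> i)))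
       \<le> real ((M + e) choose e) * C" .
    have est: "real ((M + e) choose e) * (R M k * (real (mi_fact \<alpha>) / fact k * (cmod (c \<alpha>))\<^sup>2))
        \<le> ?w k * (cmod (c \<alpha>))\<^sup>2 * (\<Sum>g\<in>?\<Gamma>. \<Prod>i\<in>UNIV. ?t g i ^ (2 * \<alpha> i))"
      if k: "k \<le> D" and \<alpha>: "\<alpha> \<in> degree_set k" for k \<alpha>
    proof -
      have Mk: "k \<le> M" using k M by simp
      have "real (mi_fact \<alpha>) / real M ^ k * real ((M + e) choose (k + e))
          = real (mi_fact \<alpha>) / real M ^ k * (\<Sum>g\<in>?\<Gamma>. \<Prod>i\<in>UNIV. real (g i choose \<alpha> i))"
        using arg_cong[OF sum_indices_choose[of "UNIV :: 'd set" \<alpha> M], of real] \<alpha>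
        by (simp add: d mi_size_def)
      also have "\<dots> = (\<Sum>g\<in>?\<Gamma>. \<Prod>i\<in>UNIV. real ((g i choose \<alpha> i) * fact (\<alpha> i)) / real M ^ \<alpha> i)"
      proof -
        have "real (mi_fact \<alpha>) / real M ^ k = (\<Prod>i\<in>UNIV. fact (\<alpha> i) / real M ^ \<alpha> i)"
          using \<alpha> by (auto simp: mi_fact_def mi_size_def power_sum prod_dividef)
        then show ?thesis by (simp add: sum_distrib_left mult.commute flip: prod.distrib)
      qed
      also have "\<dots> \<le> (\<Sum>g\<in>?\<Gamma>. \<Prod>i\<in>UNIV. real (g i ^ \<alpha> i) / real M ^ \<alpha> i)"
        by (intro sum_mono prod_mono conjI divide_right_mono of_nat_mono binomial_fact_pow) auto
      also have "\<dots> = (\<Sum>g\<in>?\<Gamma>. \<Prod>i\<in>UNIV. ?t g i ^ (2 * \<alpha> i))"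
        by (simp add: power_mult power_divide)
      finally have 1: "real (mi_fact \<alpha>) / real M ^ k * real ((M + e) choose (k + e)) \<le> (\<Sum>g\<in>?\<Gamma>. \<Prod>i\<in>UNIV. ?t g i ^ (2 * \<alpha> i))" .
      have "real ((M + e) choose e) * R M k / fact k * (fact k * fact e) = real (((M + e) choose e) * (fact M * fact e)) / (fact (M - k) * real M ^ k)"
        by (simp add: R_def)
      also have "\<dots> = real ((M + e) choose (k + e)) * fact (k + e) / real M ^ k"
        unfolding choose_ratio[OF Mk, symmetric] by simp
      also have "(fact (k + e) :: real) = real (((k + e) choose e) * (fact k * fact e))"
        using arg_cong[OF binomial_fact_lemma[of e "k + e"], of real] by (simp add: mult_ac)
      finally have "real ((M + e) choose e) * R M k / fact k * (fact k * fact e)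
          = real ((k + e) choose e) * (real ((M + e) choose (k + e)) / real M ^ k) * (fact k * fact e)"
        by simp
      then have "real ((M + e) choose e) * R M k / fact k = real ((k + e) choose e) * (real ((M + e) choose (k + e)) / real M ^ k)"
        unfolding mult_cancel_right by simp
      also have "\<dots> \<le> ?w k * (real ((M + e) choose (k + e)) / real M ^ k)"
      proof (rule mult_right_mono)
        show "real ((k + e) choose e) \<le> ?w k"
          using choose_le_power[of k e] by (metis of_nat_le_iff of_nat_power)
      qed auto
      finally have 2: "real ((M + e) choose e) * R M k / fact k \<le> ?w k * (real ((M + e) choose (k + e)) / real M ^ k)" .
      have est: "real ((M + e) choose e) * (R M k * (real (mi_fact \<alpha>) / fact k * (cmod (c \<alpha>))\<^sup>2))
          = (real ((M + e) choose e) * R M k / fact k) * (real (mi_fact \<alpha>) * (cmod (c \<alpha>))\<^sup>2)" by simp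
      also have "\<dots> \<le> (?w k * (real ((M + e) choose (k + e)) / real M ^ k)) * (real (mi_fact \<alpha>) * (cmod (c \<alpha>))\<^sup>2)"
        by (rule mult_right_mono[OF 2]) auto
      also have "\<dots> = ?w k * (cmod (c \<alpha>))\<^sup>2 * (real (mi_fact \<alpha>) / real M ^ k * real ((M + e) choose (k + e)))"
        by simp
      also have "\<dots> \<le> ?w k * (cmod (c \<alpha>))\<^sup>2 * (\<Sum>g\<in>?\<Gamma>. \<Prod>i\<in>UNIV. ?t g i ^ (2 * \<alpha> i))"
        by (rule mult_left_mono[OF 1]) auto
      finally show ?thesis .
    qed
    have "real ((M + e) choose e) * (\<Sum>k\<le>D. \<Sum>\<alpha>\<in>degree_set k. R M k * (real (mi_fact \<alpha>) / fact k * (cmod (c \<alpha>))\<^sup>2))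
      \<le> real ((M + e) choose e) * C"
      unfolding sum_distrib_left by (rule order.trans[OF _ main], intro sum_mono est) simp_all
    then show ?thesis by simp
  qed
  have "(\<lambda>M. \<Sum>k\<le>D. \<Sum>\<alpha>\<in>degree_set k. R M k * (real (mi_fact \<alpha>) / fact k * (cmod (c \<alpha>))\<^sup>2))
      \<longlonglongrightarrow> (\<Sum>k\<le>D. \<Sum>\<alpha>\<in>degree_set k. 1 * (real (mi_fact \<alpha>) / fact k * (cmod (c \<alpha>))\<^sup>2))"
    unfolding R_def by (intro tendsto_intros falling_power_ratio_tendsto)
  then show ?thesis
    using Lim_bounded[of _ _ "Suc D" C] step by (simp add: less_eq_Suc_le)
qed

section \<open>Homogeneous parts and uniqueness of coefficients\<close>

lemma homog_part_diff: "homog_part (\<lambda>\<alpha>. c \<alpha> - c' \<alpha>) k z = homog_part c k z - homog_part c' k z"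
  by (simp add: homog_part_def left_diff_distrib sum_subtractf)

text \<open>
  The sample points do not depend on the coefficients. Pointwise statements about homogeneous parts thus become
  statements about coefficients: vanishing gives uniqueness of power series, and convergence gives
  coefficientwise convergence.
\<close>

lemma coeff_bound_by_samples:
  obtains I :: "('d::finite \<Rightarrow> nat) set" and \<xi> :: "('d \<Rightarrow> nat) \<Rightarrow> complex ^ 'd" where "finite I"
    "\<And>c \<alpha>. mi_size \<alpha> = k \<Longrightarrow> (cmod (c \<alpha>))\<^sup>2 \<le> (\<Sum>g\<in>I. (cmod (homog_part c k (\<xi> g)))\<^sup>2)"
proof
  let ?w = "cis (2 * pi / Suc k)"
  let ?I = "PiE UNIV (\<lambda>_::'d. {..<Suc k})"
  show "finite ?I" by (intro finite_PiE) auto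
  fix c :: "('d \<Rightarrow> nat) \<Rightarrow> complex" and \<alpha> :: "'d \<Rightarrow> nat"
  assume \<alpha>: "mi_size \<alpha> = k"
  have "(cmod (c \<alpha>))\<^sup>2 \<le> (\<Sum>\<beta>\<in>degree_set k. (cmod (c \<beta>))\<^sup>2)"
    by (rule member_le_sum) (use \<alpha> in auto)
  also have "\<dots> = 1 * (\<Sum>\<beta>\<in>degree_set k. (cmod (c \<beta>))\<^sup>2)" by simp
  also have "\<dots> \<le> real (Suc k) ^ CARD('d) * (\<Sum>\<beta>\<in>degree_set k. (cmod (c \<beta>))\<^sup>2)"
    by (intro mult_right_mono one_le_power sum_nonneg) auto
  also have "\<dots> = (\<Sum>g\<in>?I. (cmod (homog_part c k (\<chi> i. of_real 1 * ?w ^ g i)))\<^sup>2)"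
    unfolding homog_part_def
  proof (subst torus_parseval)
    fix \<beta> :: "'d \<Rightarrow> nat" and i assume "\<beta> \<in> degree_set k"
    then show "\<beta> i < Suc k" using index_le_size[of \<beta> i] by simp
  qed auto
  finally show "(cmod (c \<alpha>))\<^sup>2 \<le> (\<Sum>g\<in>?I. (cmod (homog_part c k (\<chi> i. of_real 1 * ?w ^ g i)))\<^sup>2)" .
qed

lemma coeff_eq_0_if_homog_part_eq_0:
  assumes "\<And>z. homog_part c (mi_size \<alpha>) z = 0"
  shows "c \<alpha> = 0"
proof -
  obtain I :: "('a \<Rightarrow> nat) set" and \<xi> where "(cmod (c \<alpha>))\<^sup>2 \<le> (\<Sum>g\<in>I. (cmod (homog_part c (mi_size \<alpha>) (\<xi> g)))\<^sup>2)"
    by (rule coeff_bound_by_samples[of "mi_size \<alpha>"]) blast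
  then show ?thesis by (simp add: assms)
qed

lemma coeff_tendsto_if_homog_part_tendsto:
  assumes "\<And>z. (\<lambda>j. homog_part (c j) (mi_size \<alpha>) z) \<longlonglongrightarrow> homog_part c' (mi_size \<alpha>) z"
  shows "(\<lambda>j. c j \<alpha>) \<longlonglongrightarrow> c' \<alpha>"
proof -
  let ?k = "mi_size \<alpha>"
  obtain I :: "('a \<Rightarrow> nat) set" and \<xi> where I: "\<And>c. (cmod (c \<alpha>))\<^sup>2 \<le> (\<Sum>g\<in>I. (cmod (homog_part c ?k (\<xi> g)))\<^sup>2)"
    by (rule coeff_bound_by_samples[of ?k]) blast
  have "(\<lambda>j. \<Sum>g\<in>I. (cmod (homog_part (c j) ?k (\<xi> g) - homog_part c' ?k (\<xi> g)))\<^sup>2)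
      \<longlonglongrightarrow> (\<Sum>g\<in>I. (cmod (homog_part c' ?k (\<xi> g) - homog_part c' ?k (\<xi> g)))\<^sup>2)"
    by (intro tendsto_intros assms)
  then have lim: "(\<lambda>j. \<Sum>g\<in>I. (cmod (homog_part (\<lambda>\<beta>. c j \<beta> - c' \<beta>) ?k (\<xi> g)))\<^sup>2) \<longlonglongrightarrow> 0"
    by (simp add: homog_part_diff)
  have "(\<lambda>j. (cmod (c j \<alpha> - c' \<alpha>))\<^sup>2) \<longlonglongrightarrow> 0"
  proof (rule tendsto_sandwich[OF _ _ tendsto_const lim])
    show "\<forall>\<^sub>F j in sequentially. (cmod (c j \<alpha> - c' \<alpha>))\<^sup>2 \<le> (\<Sum>g\<in>I. (cmod (homog_part (\<lambda>\<beta>. c j \<beta> - c' \<beta>) ?k (\<xi> g)))\<^sup>2)"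
      by (intro always_eventually allI I[of "\<lambda>\<beta>. c _ \<beta> - c' \<beta>"])
  qed simp
  then have "(\<lambda>j. sqrt ((cmod (c j \<alpha> - c' \<alpha>))\<^sup>2)) \<longlonglongrightarrow> sqrt 0"
    by (rule tendsto_real_sqrt)
  then have "(\<lambda>j. cmod (c j \<alpha> - c' \<alpha>)) \<longlonglongrightarrow> 0" by simp
  then show ?thesis using LIM_zero_cancel tendsto_norm_zero_iff by blast
qed

lemma powser_coeff_eq_0:
  fixes a :: "nat \<Rightarrow> complex"
  assumes "\<And>x. cmod x < 1 \<Longrightarrow> (\<lambda>k. a k * x ^ k) sums 0"
  shows "a k = 0"
proof (induction k rule: less_induct)
  case (less k)
  have "(\<lambda>n. a (n + k) * x ^ n) sums 0" if "x \<noteq> 0" "cmod x < 1" for x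
  proof -
    have "(\<lambda>n. a (n + k) * x ^ (n + k)) sums (0 - (\<Sum>i<k. a i * x ^ i))"
      using sums_split_initial_segment[OF assms[OF that(2)], of k] by simp
    then have "(\<lambda>n. a (n + k) * x ^ (n + k) * (1 / x ^ k)) sums ((0 - (\<Sum>i<k. a i * x ^ i)) * (1 / x ^ k))"
      by (rule sums_mult2)
    then show ?thesis using that less by (simp add: power_add)
  qed
  then have "((\<lambda>_. 0) \<longlongrightarrow> a (0 + k)) (at (0 :: complex))"
    by (intro powser_limit_0_strong[of 1 "\<lambda>n. a (n + k)"]) auto
  then show ?case by (simp add: tendsto_const_iff)
qed

lemma has_sum_homog_parts:
  assumes "((\<lambda>\<alpha>. c \<alpha> * mi_power z \<alpha>) has_sum s) UNIV"
  shows "((\<lambda>k. homog_part c k z) has_sum s) UNIV"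
proof (rule has_sum_SigmaD)
  show "((\<lambda>(k, \<alpha>). c \<alpha> * mi_power z \<alpha>) has_sum s) (Sigma UNIV degree_set)"
  proof (subst has_sum_reindex_bij_betw[symmetric])
    show "bij_betw (\<lambda>\<alpha>. (mi_size \<alpha>, \<alpha>)) UNIV (Sigma UNIV degree_set)"
      by (rule bij_betwI[of _ _ _ snd]) auto
  qed (use assms in simp)
qed (simp add: homog_part_def has_sum_finiteI)

lemma norm_vector_scale: "norm (x *s z) = cmod x * norm z" for z :: "complex ^ 'd::finite"
  by (simp add: norm_vec_def L2_set_def norm_mult power_mult_distrib real_sqrt_mult flip: sum_distrib_left)

text \<open>
  On the line through \<open>z\<close> the homogeneous parts at \<open>z\<close> are the coefficients of a power series in one variable.
\<close>

lemma has_power_series_unique: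
  assumes "has_power_series f c" "has_power_series f c'"
  shows "c = c'"
proof (rule ext)
  fix \<alpha> :: "'a \<Rightarrow> nat"
  let ?e = "\<lambda>\<alpha>. c \<alpha> - c' \<alpha>"
  have ball: "homog_part ?e k z = 0" if z: "z \<in> ball 0 1" for k and z :: "complex ^ 'a"
  proof (rule powser_coeff_eq_0)
    fix x :: complex assume x: "cmod x < 1"
    have "norm (x *s z) = cmod x * norm z" by (rule norm_vector_scale)
    also have "\<dots> < 1" using mult_strict_mono[of "cmod x" 1 "norm z" 1] x z by simp
    finally have "x *s z \<in> ball 0 1" by simp
    then have "((\<lambda>\<alpha>. c \<alpha> * mi_power (x *s z) \<alpha> + - (c' \<alpha> * mi_power (x *s z) \<alpha>)) has_sum (f (x *s z) + - f (x *s z))) UNIV"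
      using assms unfolding has_power_series_def by (intro has_sum_add has_sum_uminus[THEN iffD2]) auto
    then have "((\<lambda>k. homog_part ?e k (x *s z)) has_sum 0) UNIV"
      by (intro has_sum_homog_parts) (simp add: left_diff_distrib)
    then show "(\<lambda>k. homog_part ?e k z * x ^ k) sums 0"
      by (intro has_sum_imp_sums) (simp add: homog_part_scale mult.commute)
  qed
  have "homog_part ?e k z = 0" for k and z :: "complex ^ 'a"
  proof -
    let ?x = "of_real (1 / (1 + norm z)) :: complex"
    have "cmod ?x = 1 / (1 + norm z)" unfolding norm_of_real by simp
    moreover have pos: "norm z < 1 + norm z" "1 + norm z > 0" using norm_ge_zero[of z] by linarith+
    ultimately have "cmod ?x * norm z < 1" by simp
    then have "norm (?x *s z) < 1" by (simp only: norm_vector_scale)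
    then have "homog_part ?e k (?x *s z) = 0" by (intro ball) simp
    moreover have "?x \<noteq> 0" using pos(2) unfolding of_real_eq_0_iff by simp
    ultimately show ?thesis by (metis homog_part_scale mult_eq_0_iff power_not_zero)
  qed
  then have "?e \<alpha> = 0" by (intro coeff_eq_0_if_homog_part_eq_0[of ?e])
  then show "c \<alpha> = c' \<alpha>" by simp
qed

lemma taylor_coeff_eq: "has_power_series f c \<Longrightarrow> taylor_coeff f = c"
  unfolding taylor_coeff_def by (rule some_equality) (auto intro: has_power_series_unique)

lemma has_power_series_taylor_coeff: "f \<in> H2 \<Longrightarrow> has_power_series f (taylor_coeff f)"
  unfolding H2_def analytic_ball_def using taylor_coeff_eq by auto

section \<open>The Drury-Arveson norm\<close>

definition H2_weight :: "('d::finite \<Rightarrow> nat) \<Rightarrow> real" where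
  "H2_weight \<alpha> = real (mi_fact \<alpha>) / fact (mi_size \<alpha>)"

definition H2_sqnorm :: "(complex ^ 'd::finite \<Rightarrow> complex) \<Rightarrow> real" where
  "H2_sqnorm f = (\<Sum>\<^sub>\<infinity>\<alpha>. H2_term f \<alpha>)"

lemma H2_weight_nonneg: "H2_weight \<alpha> \<ge> 0"
  by (simp add: H2_weight_def)

lemma H2_term_eq: "has_power_series f c \<Longrightarrow> H2_term f = (\<lambda>\<alpha>. H2_weight \<alpha> * (cmod (c \<alpha>))\<^sup>2)"
  by (simp add: H2_term_def H2_weight_def taylor_coeff_eq fun_eq_iff)

lemma H2_term_nonneg: "H2_term f \<alpha> \<ge> 0"
  by (simp add: H2_term_def)

lemma H2_sqnorm_nonneg: "H2_sqnorm f \<ge> 0"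
  unfolding H2_sqnorm_def by (rule infsum_nonneg) (rule H2_term_nonneg)

lemma H2_norm_less_iff: "\<epsilon> > 0 \<Longrightarrow> H2_norm f < \<epsilon> \<longleftrightarrow> H2_sqnorm f < \<epsilon>\<^sup>2"
  unfolding H2_norm_def H2_sqnorm_def[symmetric] using real_sqrt_less_iff[of "H2_sqnorm f" "\<epsilon>\<^sup>2"] by simp

lemma H2I:
  assumes "has_power_series f c" "(\<lambda>\<alpha>. H2_weight \<alpha> * (cmod (c \<alpha>))\<^sup>2) summable_on UNIV"
  shows "f \<in> H2"
  using assms H2_term_eq[OF assms(1)] unfolding H2_def analytic_ball_def by auto

lemma H2_summable: "f \<in> H2 \<Longrightarrow> H2_term f summable_on UNIV"
  by (simp add: H2_def)

lemma has_power_series_add: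
  "has_power_series f c \<Longrightarrow> has_power_series g c' \<Longrightarrow> has_power_series (\<lambda>z. f z + g z) (\<lambda>\<alpha>. c \<alpha> + c' \<alpha>)"
  unfolding has_power_series_def distrib_right by (intro ballI has_sum_add) auto

lemma has_power_series_cmult:
  "has_power_series f c \<Longrightarrow> has_power_series (\<lambda>z. a * f z) (\<lambda>\<alpha>. a * c \<alpha>)"
  unfolding has_power_series_def mult.assoc by (intro ballI has_sum_cmult_right) auto

lemma norm_add_sq_le: "(norm (x + y))\<^sup>2 \<le> 2 * (norm x)\<^sup>2 + 2 * (norm y)\<^sup>2"
proof -
  have "(norm (x + y))\<^sup>2 \<le> (norm x + norm y)\<^sup>2" by (intro power_mono norm_triangle_ineq) auto
  also have "\<dots> \<le> 2 * (norm x)\<^sup>2 + 2 * (norm y)\<^sup>2"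
    using sum_squares_bound[of "norm x" "norm y"] by (simp add: power2_sum)
  finally show ?thesis .
qed

lemma H2_add:
  assumes f: "f \<in> H2" and g: "g \<in> H2"
  shows "(\<lambda>z. f z + g z) \<in> H2" "H2_sqnorm (\<lambda>z. f z + g z) \<le> 2 * H2_sqnorm f + 2 * H2_sqnorm g"
proof -
  note F = has_power_series_taylor_coeff[OF f] and G = has_power_series_taylor_coeff[OF g]
  note FG = has_power_series_add[OF F G]
  have le: "H2_term (\<lambda>z. f z + g z) \<alpha> \<le> 2 * H2_term f \<alpha> + 2 * H2_term g \<alpha>" for \<alpha>
  proof -
    have "H2_weight \<alpha> * (cmod (taylor_coeff f \<alpha> + taylor_coeff g \<alpha>))\<^sup>2
      \<le> H2_weight \<alpha> * (2 * (cmod (taylor_coeff f \<alpha>))\<^sup>2 + 2 * (cmod (taylor_coeff g \<alpha>))\<^sup>2)"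
      by (intro mult_left_mono norm_add_sq_le H2_weight_nonneg)
    then show ?thesis unfolding H2_term_eq[OF FG] H2_term_eq[OF F] H2_term_eq[OF G] by (simp add: algebra_simps)
  qed
  have sum: "(\<lambda>\<alpha>. 2 * H2_term f \<alpha> + 2 * H2_term g \<alpha>) summable_on UNIV"
    by (intro summable_on_add summable_on_cmult_right H2_summable f g)
  have s: "H2_term (\<lambda>z. f z + g z) summable_on UNIV"
    by (rule summable_on_comparison_test[OF sum]) (auto simp: le H2_term_nonneg)
  then show "(\<lambda>z. f z + g z) \<in> H2" using FG unfolding H2_def analytic_ball_def by auto
  have "H2_sqnorm (\<lambda>z. f z + g z) \<le> (\<Sum>\<^sub>\<infinity>\<alpha>. 2 * H2_term f \<alpha> + 2 * H2_term g \<alpha>)"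
    unfolding H2_sqnorm_def by (intro infsum_mono s sum le)
  also have "\<dots> = 2 * H2_sqnorm f + 2 * H2_sqnorm g"
    unfolding H2_sqnorm_def
    by (subst infsum_add) (auto intro!: summable_on_cmult_right H2_summable f g simp: infsum_cmult_right')
  finally show "H2_sqnorm (\<lambda>z. f z + g z) \<le> 2 * H2_sqnorm f + 2 * H2_sqnorm g" .
qed

lemma H2_cmult:
  assumes f: "f \<in> H2"
  shows "(\<lambda>z. a * f z) \<in> H2" "H2_sqnorm (\<lambda>z. a * f z) = (cmod a)\<^sup>2 * H2_sqnorm f"
proof -
  note F = has_power_series_taylor_coeff[OF f]
  have eq: "H2_term (\<lambda>z. a * f z) = (\<lambda>\<alpha>. (cmod a)\<^sup>2 * H2_term f \<alpha>)"
    unfolding H2_term_eq[OF F] H2_term_eq[OF has_power_series_cmult[OF F]]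
    by (simp add: norm_mult power_mult_distrib mult_ac)
  then show "(\<lambda>z. a * f z) \<in> H2"
    using has_power_series_cmult[OF F] summable_on_cmult_right[OF H2_summable[OF f]]
    unfolding H2_def analytic_ball_def by auto
  show "H2_sqnorm (\<lambda>z. a * f z) = (cmod a)\<^sup>2 * H2_sqnorm f"
    unfolding H2_sqnorm_def eq by (rule infsum_cmult_right')
qed

lemma H2_diff:
  assumes f: "f \<in> H2" and g: "g \<in> H2"
  shows "(\<lambda>z. f z - g z) \<in> H2" "H2_sqnorm (\<lambda>z. f z - g z) \<le> 2 * H2_sqnorm f + 2 * H2_sqnorm g"
  using H2_add[OF f H2_cmult(1)[OF g, of "- 1"]] H2_cmult(2)[OF g, of "- 1"] by auto

section \<open>Bounded multiplication operators\<close>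

definition mult_bound :: "real \<Rightarrow> (complex ^ 'd::finite \<Rightarrow> complex) \<Rightarrow> bool" where
  "mult_bound B Q \<longleftrightarrow> (\<forall>f\<in>H2. (\<lambda>z. Q z * f z) \<in> H2 \<and> H2_sqnorm (\<lambda>z. Q z * f z) \<le> B * H2_sqnorm f)"

definition bounded_mult :: "(complex ^ 'd::finite \<Rightarrow> complex) \<Rightarrow> bool" where
  "bounded_mult Q \<longleftrightarrow> (\<exists>B>0. mult_bound B Q)"

lemma mult_bound_H2: "mult_bound B Q \<Longrightarrow> f \<in> H2 \<Longrightarrow> (\<lambda>z. Q z * f z) \<in> H2"
  by (simp add: mult_bound_def)

lemma mult_bound_sqnorm: "mult_bound B Q \<Longrightarrow> f \<in> H2 \<Longrightarrow> H2_sqnorm (\<lambda>z. Q z * f z) \<le> B * H2_sqnorm f"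
  by (simp add: mult_bound_def)

lemma bounded_multE:
  assumes "bounded_mult Q"
  obtains B where "B > 0" "mult_bound B Q"
  using assms unfolding bounded_mult_def by blast

lemma bounded_mult_H2: "bounded_mult Q \<Longrightarrow> f \<in> H2 \<Longrightarrow> (\<lambda>z. Q z * f z) \<in> H2"
  unfolding bounded_mult_def using mult_bound_H2 by blast

lemma Mult_H2D: "\<phi> \<in> Mult_H2 \<Longrightarrow> f \<in> H2 \<Longrightarrow> (\<lambda>z. \<phi> z * f z) \<in> H2"
  by (simp add: Mult_H2_def)

lemma bounded_mult_imp_Mult: "bounded_mult Q \<Longrightarrow> Q \<in> Mult_H2"
  unfolding Mult_H2_def by (simp add: bounded_mult_H2)

lemma bounded_mult_const: "bounded_mult (\<lambda>_. a)"
proof -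
  have "mult_bound ((cmod a)\<^sup>2 + 1) (\<lambda>_. a)"
    unfolding mult_bound_def by (simp add: H2_cmult distrib_right H2_sqnorm_nonneg)
  moreover have "(cmod a)\<^sup>2 + 1 > 0" by (simp add: add_nonneg_pos)
  ultimately show ?thesis unfolding bounded_mult_def by blast
qed

lemma bounded_mult_add:
  assumes "bounded_mult P" "bounded_mult Q"
  shows "bounded_mult (\<lambda>z. P z + Q z)"
proof -
  obtain A where A: "A > 0" "mult_bound A P" using assms(1) by (rule bounded_multE)
  obtain B where B: "B > 0" "mult_bound B Q" using assms(2) by (rule bounded_multE)
  have "mult_bound (2 * A + 2 * B) (\<lambda>z. P z + Q z)"
    unfolding mult_bound_def distrib_right
  proof (intro ballI conjI)
    fix f :: "complex ^ 'a \<Rightarrow> complex" assume f: "f \<in> H2"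
    note m = mult_bound_H2[OF A(2) f] mult_bound_H2[OF B(2) f]
    show "(\<lambda>z. P z * f z + Q z * f z) \<in> H2" by (rule H2_add(1)[OF m])
    show "H2_sqnorm (\<lambda>z. P z * f z + Q z * f z) \<le> 2 * A * H2_sqnorm f + 2 * B * H2_sqnorm f"
      using H2_add(2)[OF m] mult_bound_sqnorm[OF A(2) f] mult_bound_sqnorm[OF B(2) f] by linarith
  qed
  moreover have "2 * A + 2 * B > 0" using A B by simp
  ultimately show ?thesis unfolding bounded_mult_def by blast
qed

lemma bounded_mult_mult:
  assumes "bounded_mult P" "bounded_mult Q"
  shows "bounded_mult (\<lambda>z. P z * Q z)"
proof -
  obtain A where A: "A > 0" "mult_bound A P" using assms(1) by (rule bounded_multE)
  obtain B where B: "B > 0" "mult_bound B Q" using assms(2) by (rule bounded_multE)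
  have "mult_bound (A * B) (\<lambda>z. P z * Q z)"
    unfolding mult_bound_def mult.assoc
  proof (intro ballI conjI)
    fix f :: "complex ^ 'a \<Rightarrow> complex" assume f: "f \<in> H2"
    note m = mult_bound_H2[OF B(2) f]
    show "(\<lambda>z. P z * (Q z * f z)) \<in> H2" by (rule mult_bound_H2[OF A(2) m])
    have "H2_sqnorm (\<lambda>z. P z * (Q z * f z)) \<le> A * H2_sqnorm (\<lambda>z. Q z * f z)"
      by (rule mult_bound_sqnorm[OF A(2) m])
    also have "\<dots> \<le> A * (B * H2_sqnorm f)"
      using A(1) mult_bound_sqnorm[OF B(2) f] by (intro mult_left_mono) simp_all
    finally show "H2_sqnorm (\<lambda>z. P z * (Q z * f z)) \<le> A * (B * H2_sqnorm f)" .
  qed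
  moreover have "A * B > 0" using A B by simp
  ultimately show ?thesis unfolding bounded_mult_def by blast
qed

lemma bounded_mult_power: "bounded_mult P \<Longrightarrow> bounded_mult (\<lambda>z. P z ^ k)"
  by (induction k) (simp_all add: bounded_mult_const bounded_mult_mult)

lemma bounded_mult_sum: "finite A \<Longrightarrow> (\<And>x. x \<in> A \<Longrightarrow> bounded_mult (P x)) \<Longrightarrow> bounded_mult (\<lambda>z. \<Sum>x\<in>A. P x z)"
  by (induction A rule: finite_induct) (simp_all add: bounded_mult_const bounded_mult_add)

lemma bounded_mult_prod: "finite A \<Longrightarrow> (\<And>x. x \<in> A \<Longrightarrow> bounded_mult (P x)) \<Longrightarrow> bounded_mult (\<lambda>z. \<Prod>x\<in>A. P x z)"
  by (induction A rule: finite_induct) (simp_all add: bounded_mult_const bounded_mult_mult)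

text \<open>
  Multiplication by \<open>z\<^sub>i\<close> shifts the coefficients, and the shift multiplies the weight \<open>\<alpha>! / \<bar>\<alpha>\<bar>!\<close> by
  \<open>(\<alpha>\<^sub>i + 1) / (\<bar>\<alpha>\<bar> + 1) \<le> 1\<close>.
\<close>

lemma mult_bound_coordinate: "mult_bound 1 (\<lambda>z. z $ i)"
  unfolding mult_bound_def
proof
  fix f :: "complex ^ 'a \<Rightarrow> complex" assume f: "f \<in> H2"
  define c where "c = taylor_coeff f"
  have F: "has_power_series f c" using has_power_series_taylor_coeff[OF f] by (simp add: c_def)
  let ?h = "\<lambda>\<alpha> :: 'a \<Rightarrow> nat. \<alpha>(i := \<alpha> i + 1)"
  define c' where "c' \<beta> = (if \<beta> i = 0 then 0 else c (\<beta>(i := \<beta> i - 1)))" for \<beta>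
  have inj: "inj ?h"
  proof (rule injI)
    fix \<alpha> \<beta> :: "'a \<Rightarrow> nat" assume *: "?h \<alpha> = ?h \<beta>"
    have "\<alpha> j = \<beta> j" for j using fun_cong[OF *, of j] by (cases "j = i") auto
    then show "\<alpha> = \<beta>" by auto
  qed
  have c'h: "c' (?h \<alpha>) = c \<alpha>" for \<alpha> by (simp add: c'_def)
  have out: "c' \<beta> = 0" if "\<beta> \<notin> range ?h" for \<beta>
  proof (rule ccontr)
    assume "c' \<beta> \<noteq> 0"
    then have "\<beta> = ?h (\<beta>(i := \<beta> i - 1))" by (auto simp: c'_def fun_eq_iff split: if_splits)
    then show False using that by blast
  qed
  have prods: "(\<Prod>j\<in>UNIV - {i}. F j (?h \<alpha> j)) = (\<Prod>j\<in>UNIV - {i}. F j (\<alpha> j))" for F :: "'a \<Rightarrow> nat \<Rightarrow> 'c::comm_monoid_mult" and \<alpha>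
    by (rule prod.cong) auto
  have power_h: "mi_power z (?h \<alpha>) = z $ i * mi_power z \<alpha>" for z \<alpha>
    unfolding mi_power_def prod.remove[OF finite UNIV_I, of _ i] prods[of "\<lambda>j k. z $ j ^ k"] by simp
  have fact_h: "mi_fact (?h \<alpha>) = (\<alpha> i + 1) * mi_fact \<alpha>" for \<alpha>
    unfolding mi_fact_def prod.remove[OF finite UNIV_I, of _ i] prods[of "\<lambda>j k. fact k"] by (simp add: distrib_right mult.assoc)
  have size_h: "mi_size (?h \<alpha>) = mi_size \<alpha> + 1" for \<alpha>
  proof -
    have "(\<Sum>j\<in>UNIV - {i}. ?h \<alpha> j) = (\<Sum>j\<in>UNIV - {i}. \<alpha> j)" by (rule sum.cong) auto
    then show ?thesis unfolding mi_size_def sum.remove[OF finite UNIV_I, of _ i] by simp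
  qed
  have weight_h: "H2_weight (?h \<alpha>) \<le> H2_weight \<alpha>" for \<alpha>
  proof -
    have "H2_weight (?h \<alpha>) = real (\<alpha> i + 1) / real (mi_size \<alpha> + 1) * H2_weight \<alpha>"
      unfolding H2_weight_def fact_h size_h by (simp add: distrib_right)
    also have "\<dots> \<le> 1 * H2_weight \<alpha>"
      using index_le_size[of \<alpha> i] by (intro mult_right_mono H2_weight_nonneg) auto
    finally show ?thesis by simp
  qed
  have ps: "has_power_series (\<lambda>z. z $ i * f z) c'"
    unfolding has_power_series_def
  proof
    fix z :: "complex ^ 'a" assume z: "z \<in> ball 0 1"
    have "((\<lambda>\<alpha>. z $ i * (c \<alpha> * mi_power z \<alpha>)) has_sum (z $ i * f z)) UNIV"
      using F z unfolding has_power_series_def by (intro has_sum_cmult_right) auto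
    then have "((\<lambda>\<beta>. c' \<beta> * mi_power z \<beta>) has_sum (z $ i * f z)) (range ?h)"
      unfolding has_sum_reindex[OF inj] o_def c'h power_h by (simp add: mult_ac)
    then show "((\<lambda>\<beta>. c' \<beta> * mi_power z \<beta>) has_sum (z $ i * f z)) UNIV"
      by (rule has_sum_cong_neutral[THEN iffD1, rotated -1]) (auto simp: out)
  qed
  let ?T = "\<lambda>\<beta>. H2_weight \<beta> * (cmod (c' \<beta>))\<^sup>2"
  have le: "?T (?h \<alpha>) \<le> H2_term f \<alpha>" for \<alpha>
    unfolding H2_term_eq[OF F] c'h by (intro mult_right_mono weight_h) auto
  have s: "(\<lambda>\<alpha>. ?T (?h \<alpha>)) summable_on UNIV"
    by (rule summable_on_comparison_test[OF H2_summable[OF f]]) (rule le, intro mult_nonneg_nonneg H2_weight_nonneg zero_le_power2)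
  then have "?T summable_on (range ?h)"
    unfolding summable_on_reindex[OF inj] o_def .
  then have "?T summable_on UNIV"
    by (rule summable_on_cong_neutral[THEN iffD1, rotated -1]) (auto simp: out)
  then have mem: "(\<lambda>z. z $ i * f z) \<in> H2" by (rule H2I[OF ps])
  have "H2_sqnorm (\<lambda>z. z $ i * f z) = infsum ?T UNIV"
    unfolding H2_sqnorm_def H2_term_eq[OF ps] ..
  also have "\<dots> = infsum ?T (range ?h)"
    by (rule infsum_cong_neutral) (auto simp: out)
  also have "\<dots> = (\<Sum>\<^sub>\<infinity>\<alpha>. ?T (?h \<alpha>))"
    unfolding infsum_reindex[OF inj] o_def ..
  also have "\<dots> \<le> 1 * H2_sqnorm f"
    unfolding H2_sqnorm_def mult_1_left by (intro infsum_mono s H2_summable f le)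
  finally show "(\<lambda>z. z $ i * f z) \<in> H2 \<and> H2_sqnorm (\<lambda>z. z $ i * f z) \<le> 1 * H2_sqnorm f"
    using mem by simp
qed

lemma bounded_mult_coordinate: "bounded_mult (\<lambda>z. z $ i)"
  unfolding bounded_mult_def using mult_bound_coordinate zero_less_one by blast

section \<open>Polynomials in several variables\<close>

definition polyfun :: "(complex ^ 'd::finite \<Rightarrow> complex) \<Rightarrow> bool" where
  "polyfun f \<longleftrightarrow> (\<exists>A c. finite A \<and> f = (\<lambda>z. \<Sum>\<alpha>\<in>A. c \<alpha> * mi_power z \<alpha>))"

lemma polyfun_bounded_mult:
  assumes "polyfun f"
  shows "bounded_mult f"
proof -
  obtain A c where A: "finite A" and f: "f = (\<lambda>z. \<Sum>\<alpha>\<in>A. c \<alpha> * mi_power z \<alpha>)"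
    using assms unfolding polyfun_def by blast
  have "bounded_mult (\<lambda>z. mi_power z \<alpha>)" for \<alpha> :: "'a \<Rightarrow> nat"
    unfolding mi_power_def by (rule bounded_mult_prod[OF finite], rule bounded_mult_power, rule bounded_mult_coordinate)
  then show ?thesis
    unfolding f by (intro bounded_mult_sum[OF A] bounded_mult_mult[OF bounded_mult_const])
qed

lemma has_power_series_polyfun:
  assumes "finite A"
  shows "has_power_series (\<lambda>z. \<Sum>\<alpha>\<in>A. c \<alpha> * mi_power z \<alpha>) (\<lambda>\<alpha>. if \<alpha> \<in> A then c \<alpha> else 0)"
  unfolding has_power_series_def
  by (intro ballI has_sum_finite_neutralI[of A]) (use assms in auto)

lemma polyfun_power_series:
  assumes "polyfun f"
  obtains A c where "finite A" "has_power_series f c" "\<And>\<alpha>. \<alpha> \<notin> A \<Longrightarrow> c \<alpha> = 0"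
proof -
  obtain A c where A: "finite A" and f: "f = (\<lambda>z. \<Sum>\<alpha>\<in>A. c \<alpha> * mi_power z \<alpha>)"
    using assms unfolding polyfun_def by blast
  show ?thesis
    by (rule that[OF A has_power_series_polyfun[OF A, of c, folded f]]) simp
qed

lemma finite_support_H2:
  assumes "finite A" "has_power_series f c" "\<And>\<alpha>. \<alpha> \<notin> A \<Longrightarrow> c \<alpha> = 0"
  shows "f \<in> H2" "H2_sqnorm f = (\<Sum>\<alpha>\<in>A. H2_weight \<alpha> * (cmod (c \<alpha>))\<^sup>2)"
proof -
  have "((\<lambda>\<alpha>. H2_weight \<alpha> * (cmod (c \<alpha>))\<^sup>2) has_sum (\<Sum>\<alpha>\<in>A. H2_weight \<alpha> * (cmod (c \<alpha>))\<^sup>2)) UNIV"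
    by (rule has_sum_finite_neutralI[of A]) (use assms in auto)
  then show "f \<in> H2" "H2_sqnorm f = (\<Sum>\<alpha>\<in>A. H2_weight \<alpha> * (cmod (c \<alpha>))\<^sup>2)"
    using H2I[OF assms(2)] H2_term_eq[OF assms(2)] unfolding H2_sqnorm_def by (auto simp: summable_on_def infsumI)
qed

lemma polyfun_H2: "polyfun f \<Longrightarrow> f \<in> H2"
  by (erule polyfun_power_series) (rule finite_support_H2)

lemma in_cyclic_subspace_iff:
  "g \<in> cyclic_subspace f \<longleftrightarrow> g \<in> H2 \<and> (\<forall>\<epsilon>>0. \<exists>\<phi>\<in>Mult_H2. H2_norm (\<lambda>z. g z - \<phi> z * f z) < \<epsilon>)"
  unfolding cyclic_subspace_def H2_closure_def setcompr_eq_image by simp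

lemma polyfun_monomial: "polyfun (\<lambda>z. a * mi_power z \<alpha>)"
  unfolding polyfun_def by (intro exI[of _ "{\<alpha>}"] exI[of _ "\<lambda>_. a"]) simp

lemma polyfun_add:
  assumes "polyfun f" "polyfun g"
  shows "polyfun (\<lambda>z. f z + g z)"
proof -
  obtain A c where A: "finite A" "f = (\<lambda>z. \<Sum>\<alpha>\<in>A. c \<alpha> * mi_power z \<alpha>)" using assms(1) unfolding polyfun_def by blast
  obtain B c' where B: "finite B" "g = (\<lambda>z. \<Sum>\<alpha>\<in>B. c' \<alpha> * mi_power z \<alpha>)" using assms(2) unfolding polyfun_def by blast
  let ?c = "\<lambda>\<alpha>. (if \<alpha> \<in> A then c \<alpha> else 0) + (if \<alpha> \<in> B then c' \<alpha> else 0)"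
  have 1: "f z = (\<Sum>\<alpha>\<in>A \<union> B. (if \<alpha> \<in> A then c \<alpha> else 0) * mi_power z \<alpha>)" for z
    unfolding A(2) by (rule sum.mono_neutral_cong_left) (use A(1) B(1) in auto)
  have 2: "g z = (\<Sum>\<alpha>\<in>A \<union> B. (if \<alpha> \<in> B then c' \<alpha> else 0) * mi_power z \<alpha>)" for z
    unfolding B(2) by (rule sum.mono_neutral_cong_left) (use A(1) B(1) in auto)
  have eq: "(\<lambda>z. f z + g z) = (\<lambda>z. \<Sum>\<alpha>\<in>A \<union> B. ?c \<alpha> * mi_power z \<alpha>)"
    unfolding distrib_right sum.distrib 1 2 ..
  have "finite (A \<union> B)" using A(1) B(1) by simp
  then show ?thesis unfolding polyfun_def by (intro exI conjI) (assumption, rule eq)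
qed

lemma polyfun_0: "polyfun (\<lambda>z. 0)"
  unfolding polyfun_def by (intro exI[of _ "{}"]) auto

lemma polyfun_sum: "finite A \<Longrightarrow> (\<And>x. x \<in> A \<Longrightarrow> polyfun (P x)) \<Longrightarrow> polyfun (\<lambda>z. \<Sum>x\<in>A. P x z)"
  by (induction A rule: finite_induct) (simp_all add: polyfun_0 polyfun_add)

lemma polyfun_mult:
  assumes "polyfun f" "polyfun g"
  shows "polyfun (\<lambda>z. f z * g z)"
proof -
  obtain A c where A: "finite A" "f = (\<lambda>z. \<Sum>\<alpha>\<in>A. c \<alpha> * mi_power z \<alpha>)" using assms(1) unfolding polyfun_def by blast
  obtain B c' where B: "finite B" "g = (\<lambda>z. \<Sum>\<alpha>\<in>B. c' \<alpha> * mi_power z \<alpha>)" using assms(2) unfolding polyfun_def by blast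
  have eq: "(\<lambda>z. f z * g z) = (\<lambda>z. \<Sum>\<alpha>\<in>A. \<Sum>\<beta>\<in>B. (c \<alpha> * c' \<beta>) * mi_power z (\<lambda>i. \<alpha> i + \<beta> i))"
    unfolding A(2) B(2) sum_product mi_power_mult by (simp add: mult_ac)
  show ?thesis unfolding eq by (intro polyfun_sum[OF A(1)] polyfun_sum[OF B(1)] polyfun_monomial)
qed

lemma polyfun_const: "polyfun (\<lambda>_. a)"
  using polyfun_monomial[of a "\<lambda>_. 0"] by (simp add: mi_power_def)

lemma polyfun_power: "polyfun f \<Longrightarrow> polyfun (\<lambda>z. f z ^ k)"
  by (induction k) (simp_all add: polyfun_const polyfun_mult)

lemma polyfun_dense:
  assumes f: "f \<in> H2" and \<epsilon>: "\<epsilon> > 0"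
  shows "\<exists>Q. polyfun Q \<and> H2_sqnorm (\<lambda>z. f z - Q z) \<le> \<epsilon>"
proof -
  define c where "c = taylor_coeff f"
  have F: "has_power_series f c" using has_power_series_taylor_coeff[OF f] by (simp add: c_def)
  obtain A where A: "finite A" "dist (sum (H2_term f) A) (infsum (H2_term f) UNIV) \<le> \<epsilon>"
    using infsum_finite_approximation[OF H2_summable[OF f] \<epsilon>] by blast
  let ?Q = "\<lambda>z. \<Sum>\<alpha>\<in>A. c \<alpha> * mi_power z \<alpha>"
  let ?e = "\<lambda>\<alpha>. if \<alpha> \<in> A then 0 else c \<alpha>"
  have "has_power_series (\<lambda>z. f z + (- 1) * ?Q z) (\<lambda>\<alpha>. c \<alpha> + (- 1) * (if \<alpha> \<in> A then c \<alpha> else 0))"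
    by (intro has_power_series_add has_power_series_cmult has_power_series_polyfun F A)
  also have "(\<lambda>\<alpha>. c \<alpha> + (- 1) * (if \<alpha> \<in> A then c \<alpha> else 0)) = ?e" by auto
  finally have "has_power_series (\<lambda>z. f z - ?Q z) ?e" by simp
  then have "H2_sqnorm (\<lambda>z. f z - ?Q z) = (\<Sum>\<^sub>\<infinity>\<alpha>. H2_weight \<alpha> * (cmod (?e \<alpha>))\<^sup>2)"
    unfolding H2_sqnorm_def by (simp add: H2_term_eq)
  also have "\<dots> = infsum (H2_term f) (UNIV - A)"
    unfolding H2_term_eq[OF F] by (rule infsum_cong_neutral) auto
  also have "\<dots> = infsum (H2_term f) UNIV - infsum (H2_term f) A"
    by (rule infsum_Diff) (use A H2_summable[OF f] in auto)
  also have "\<dots> \<le> \<epsilon>" using A by (simp add: dist_real_def)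
  finally have le: "H2_sqnorm (\<lambda>z. f z - ?Q z) \<le> \<epsilon>" .
  have "polyfun ?Q" unfolding polyfun_def by (intro exI conjI) (rule A(1), rule refl)
  then show ?thesis using le by (intro exI[of _ ?Q] conjI)
qed

section \<open>Products of power series in one variable\<close>

text \<open>
  Uniform bounds on partial sums avoid any discussion of convergence. The weight \<open>(k + 1)\<^sup>s\<close> is the one that
  \<open>sphere_norm_bound\<close> asks for when \<open>s = d - 1\<close>.
\<close>

definition l1_bounded :: "complex fps \<Rightarrow> real \<Rightarrow> bool" where
  "l1_bounded F C \<longleftrightarrow> (\<forall>K. (\<Sum>k\<le>K. cmod (fps_nth F k)) \<le> C)"

definition l2_bounded :: "nat \<Rightarrow> complex fps \<Rightarrow> real \<Rightarrow> bool" where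
  "l2_bounded s F C \<longleftrightarrow> (\<forall>K. (\<Sum>k\<le>K. real (k + 1) ^ s * (cmod (fps_nth F k))\<^sup>2) \<le> C)"

lemma sum_antidiagonals_le:
  fixes f g :: "nat \<Rightarrow> real"
  assumes "\<And>i. f i \<ge> 0" "\<And>i. g i \<ge> 0"
  shows "(\<Sum>k\<le>K. \<Sum>i\<le>k. f i * g (k - i)) \<le> (\<Sum>i\<le>K. f i) * (\<Sum>j\<le>K. g j)"
proof -
  have "(\<Sum>k\<le>K. \<Sum>i\<le>k. f i * g (k - i)) = (\<Sum>(i,j)\<in>{(i,j). i + j \<le> K}. f i * g j)"
    by (simp add: sum.triangle_reindex_eq)
  also have "\<dots> \<le> (\<Sum>(i,j)\<in>{..K} \<times> {..K}. f i * g j)"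
    by (rule sum_mono2) (use assms in auto)
  also have "\<dots> = (\<Sum>i\<le>K. f i) * (\<Sum>j\<le>K. g j)"
    by (simp add: sum_product sum.cartesian_product)
  finally show ?thesis .
qed

lemma cmod_fps_mult_nth_le:
  "cmod (fps_nth (F * G) k) \<le> (\<Sum>i\<le>k. cmod (fps_nth F i) * cmod (fps_nth G (k - i)))"
  unfolding fps_mult_nth atLeast0AtMost by (rule sum_norm_le) (simp add: norm_mult)

lemma l1_bounded_mult:
  assumes "l1_bounded F A" "l1_bounded G B"
  shows "l1_bounded (F * G) (A * B)"
  unfolding l1_bounded_def
proof
  fix K
  have A: "0 \<le> A"
    using assms(1) unfolding l1_bounded_def by (meson norm_ge_zero order.trans sum_nonneg)
  have "(\<Sum>k\<le>K. cmod (fps_nth (F * G) k)) \<le> (\<Sum>k\<le>K. \<Sum>i\<le>k. cmod (fps_nth F i) * cmod (fps_nth G (k - i)))"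
    by (intro sum_mono cmod_fps_mult_nth_le)
  also have "\<dots> \<le> (\<Sum>i\<le>K. cmod (fps_nth F i)) * (\<Sum>j\<le>K. cmod (fps_nth G j))"
    by (rule sum_antidiagonals_le) auto
  also have "\<dots> \<le> A * B"
    using assms A unfolding l1_bounded_def by (intro mult_mono sum_nonneg) auto
  finally show "(\<Sum>k\<le>K. cmod (fps_nth (F * G) k)) \<le> A * B" .
qed

text \<open>
  Young's inequality for the convolution of \<open>\<ell>\<^sup>2\<close> with \<open>\<ell>\<^sup>1\<close>. The restriction to \<open>k \<le> 2 i\<close> allows the weight \<open>(k + 1)\<^sup>s\<close> to be
  moved to \<open>f\<close> at the cost of the factor \<open>2\<^sup>s\<close>.
\<close>

lemma weighted_antidiagonal_bound:
  fixes f g :: "nat \<Rightarrow> real"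
  assumes "\<And>i. f i \<ge> 0" "\<And>i. g i \<ge> 0"
    and f: "(\<Sum>i\<le>K. real (i + 1) ^ s * (f i)\<^sup>2) \<le> A" and g: "(\<Sum>i\<le>K. g i) \<le> B"
  shows "(\<Sum>k\<le>K. real (k + 1) ^ s * (\<Sum>i | i \<le> k \<and> k \<le> 2 * i. f i * g (k - i))\<^sup>2) \<le> 2 ^ s * A * B\<^sup>2"
proof -
  have B: "B \<ge> 0" using g assms(2) by (meson order.trans sum_nonneg)
  have A: "A \<ge> 0" using f by (meson order.trans sum_nonneg mult_nonneg_nonneg zero_le_power2 zero_le_power of_nat_0_le_iff)
  have each: "real (k + 1) ^ s * (\<Sum>i | i \<le> k \<and> k \<le> 2 * i. f i * g (k - i))\<^sup>2
      \<le> B * 2 ^ s * (\<Sum>i\<le>k. (real (i + 1) ^ s * (f i)\<^sup>2) * g (k - i))" if k: "k \<le> K" for k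
  proof -
    let ?I = "{i. i \<le> k \<and> k \<le> 2 * i}"
    have fin: "finite ?I" by simp
    have "(\<Sum>i\<in>?I. f i * g (k - i))\<^sup>2 = (\<Sum>i\<in>?I. (f i * sqrt (g (k - i))) * sqrt (g (k - i)))\<^sup>2"
      using assms by (simp add: mult.assoc)
    also have "\<dots> \<le> (\<Sum>i\<in>?I. (f i * sqrt (g (k - i)))\<^sup>2) * (\<Sum>i\<in>?I. (sqrt (g (k - i)))\<^sup>2)"
      by (rule Cauchy_Schwarz_ineq_sum)
    also have "\<dots> = (\<Sum>i\<in>?I. (f i)\<^sup>2 * g (k - i)) * (\<Sum>i\<in>?I. g (k - i))"
      using assms by (simp add: power_mult_distrib)
    also have "\<dots> \<le> (\<Sum>i\<in>?I. (f i)\<^sup>2 * g (k - i)) * B"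
    proof (rule mult_left_mono)
      have "(\<Sum>i\<in>?I. g (k - i)) \<le> (\<Sum>i\<le>k. g (k - i))"
        by (rule sum_mono2) (use assms in auto)
      also have "\<dots> = (\<Sum>i\<le>k. g i)"
        by (rule sum.reindex_bij_witness[of _ "\<lambda>i. k - i" "\<lambda>i. k - i"]) auto
      also have "\<dots> \<le> (\<Sum>i\<le>K. g i)"
        by (rule sum_mono2) (use assms k in auto)
      finally show "(\<Sum>i\<in>?I. g (k - i)) \<le> B" using g by simp
    qed (use assms in \<open>auto intro: sum_nonneg\<close>)
    finally have "real (k + 1) ^ s * (\<Sum>i\<in>?I. f i * g (k - i))\<^sup>2 \<le> real (k + 1) ^ s * ((\<Sum>i\<in>?I. (f i)\<^sup>2 * g (k - i)) * B)"
      by (rule mult_left_mono) auto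
    also have "\<dots> = B * (\<Sum>i\<in>?I. real (k + 1) ^ s * (f i)\<^sup>2 * g (k - i))"
      by (simp add: sum_distrib_left sum_distrib_right mult_ac)
    also have "\<dots> \<le> B * (\<Sum>i\<in>?I. (2 ^ s * real (i + 1) ^ s) * (f i)\<^sup>2 * g (k - i))"
    proof (intro mult_left_mono[OF _ B] sum_mono mult_right_mono)
      fix i assume "i \<in> ?I"
      then have "real (k + 1) ^ s \<le> (2 * real (i + 1)) ^ s" by (intro power_mono) auto
      then show "real (k + 1) ^ s \<le> 2 ^ s * real (i + 1) ^ s" by (simp only: power_mult_distrib)
    qed (use assms in auto)
    also have "\<dots> \<le> B * (\<Sum>i\<le>k. (2 ^ s * real (i + 1) ^ s) * (f i)\<^sup>2 * g (k - i))"
      by (intro mult_left_mono[OF _ B] sum_mono2) (use assms in auto)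
    also have "\<dots> = B * 2 ^ s * (\<Sum>i\<le>k. (real (i + 1) ^ s * (f i)\<^sup>2) * g (k - i))"
      by (simp add: sum_distrib_left mult_ac)
    finally show ?thesis .
  qed
  have "(\<Sum>k\<le>K. real (k + 1) ^ s * (\<Sum>i | i \<le> k \<and> k \<le> 2 * i. f i * g (k - i))\<^sup>2)
      \<le> (\<Sum>k\<le>K. B * 2 ^ s * (\<Sum>i\<le>k. (real (i + 1) ^ s * (f i)\<^sup>2) * g (k - i)))"
    by (intro sum_mono each) simp
  also have "\<dots> = B * 2 ^ s * (\<Sum>k\<le>K. \<Sum>i\<le>k. (real (i + 1) ^ s * (f i)\<^sup>2) * g (k - i))"
    by (simp add: sum_distrib_left)
  also have "\<dots> \<le> B * 2 ^ s * ((\<Sum>i\<le>K. real (i + 1) ^ s * (f i)\<^sup>2) * (\<Sum>i\<le>K. g i))"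
    by (intro mult_left_mono sum_antidiagonals_le) (use assms B in auto)
  also have "\<dots> \<le> B * 2 ^ s * (A * B)"
    by (intro mult_left_mono mult_mono f g) (use assms B A in \<open>auto intro: sum_nonneg\<close>)
  finally show ?thesis by (simp add: power2_eq_square mult_ac)
qed

text \<open>
  In each product \<open>F\<^sub>i G\<^sub>j\<close> the factor with the larger index carries the weight. This is why the weighted
  square sums are multiplicative only together with the unweighted absolute sums.
\<close>

lemma l2_bounded_mult:
  assumes F: "l1_bounded F A1" "l2_bounded s F A2" and G: "l1_bounded G B1" "l2_bounded s G B2"
  shows "l2_bounded s (F * G) (2 ^ (s + 1) * (A2 * B1\<^sup>2 + B2 * A1\<^sup>2))"
  unfolding l2_bounded_def
proof
  fix K
  let ?f = "\<lambda>k. cmod (fps_nth F k)" and ?g = "\<lambda>k. cmod (fps_nth G k)"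
  let ?X = "\<lambda>k. \<Sum>i | i \<le> k \<and> k \<le> 2 * i. ?f i * ?g (k - i)"
  let ?Y = "\<lambda>k. \<Sum>i | i \<le> k \<and> k \<le> 2 * i. ?g i * ?f (k - i)"
  have "(cmod (fps_nth (F * G) k))\<^sup>2 \<le> 2 * (?X k)\<^sup>2 + 2 * (?Y k)\<^sup>2" for k
  proof -
    have "cmod (fps_nth (F * G) k) \<le> (\<Sum>i\<le>k. ?f i * ?g (k - i))"
      by (rule cmod_fps_mult_nth_le)
    also have "\<dots> \<le> (\<Sum>i\<in>{i. i \<le> k \<and> k \<le> 2 * i} \<union> {i. i \<le> k \<and> k \<le> 2 * (k - i)}. ?f i * ?g (k - i))"
      by (rule sum_mono2) auto
    also have "\<dots> \<le> ?X k + (\<Sum>i | i \<le> k \<and> k \<le> 2 * (k - i). ?f i * ?g (k - i))"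
      by (subst sum.union_inter[symmetric]) (auto intro: sum_nonneg)
    also have "(\<Sum>i | i \<le> k \<and> k \<le> 2 * (k - i). ?f i * ?g (k - i)) = ?Y k"
      by (rule sum.reindex_bij_witness[of _ "\<lambda>i. k - i" "\<lambda>i. k - i"]) auto
    finally have "(cmod (fps_nth (F * G) k))\<^sup>2 \<le> (?X k + ?Y k)\<^sup>2"
      by (intro power_mono) auto
    also have "\<dots> \<le> 2 * (?X k)\<^sup>2 + 2 * (?Y k)\<^sup>2"
      using sum_squares_bound[of "?X k" "?Y k"] by (simp add: power2_sum)
    finally show ?thesis .
  qed
  then have "(\<Sum>k\<le>K. real (k + 1) ^ s * (cmod (fps_nth (F * G) k))\<^sup>2)
      \<le> (\<Sum>k\<le>K. real (k + 1) ^ s * (2 * (?X k)\<^sup>2 + 2 * (?Y k)\<^sup>2))"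
    by (intro sum_mono mult_left_mono) auto
  also have "\<dots> = 2 * (\<Sum>k\<le>K. real (k + 1) ^ s * (?X k)\<^sup>2) + 2 * (\<Sum>k\<le>K. real (k + 1) ^ s * (?Y k)\<^sup>2)"
    by (simp add: sum_distrib_left distrib_left sum.distrib mult_ac)
  also have "\<dots> \<le> 2 * (2 ^ s * A2 * B1\<^sup>2) + 2 * (2 ^ s * B2 * A1\<^sup>2)"
    using F G by (intro add_mono mult_left_mono weighted_antidiagonal_bound) (auto simp: l1_bounded_def l2_bounded_def)
  also have "\<dots> = 2 ^ (s + 1) * (A2 * B1\<^sup>2 + B2 * A1\<^sup>2)" by (simp add: algebra_simps)
  finally show "(\<Sum>k\<le>K. real (k + 1) ^ s * (cmod (fps_nth (F * G) k))\<^sup>2) \<le> 2 ^ (s + 1) * (A2 * B1\<^sup>2 + B2 * A1\<^sup>2)" .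
qed

section \<open>The quotient of one linear factor\<close>

text \<open>
  The sum is a partial sum of the expansion of \<open>1 / (1 - r)\<^sup>s\<^sup>+\<^sup>1\<close>.
\<close>

lemma binomial_geometric_sum_le:
  fixes r :: real
  assumes "0 \<le> r" "r \<le> 1"
  shows "(1 - r) ^ Suc s * (\<Sum>k\<le>K. real ((k + s) choose s) * r ^ k) \<le> 1"
proof (induction s)
  case 0
  show ?case using assms by (simp add: sum_gp_basic)
next
  case (Suc s)
  have "(1 - r) * (\<Sum>k\<le>K. real ((k + Suc s) choose Suc s) * r ^ k)
     = (\<Sum>k\<le>K. real ((k + s) choose s) * r ^ k) - real ((K + Suc s) choose Suc s) * r ^ Suc K"
    by (induction K) (simp_all add: algebra_simps)
  also have "\<dots> \<le> (\<Sum>k\<le>K. real ((k + s) choose s) * r ^ k)"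
    using assms by simp
  finally have "(1 - r) ^ Suc s * ((1 - r) * (\<Sum>k\<le>K. real ((k + Suc s) choose Suc s) * r ^ k))
    \<le> (1 - r) ^ Suc s * (\<Sum>k\<le>K. real ((k + s) choose s) * r ^ k)"
    using assms by (intro mult_left_mono) auto
  then show ?case using Suc.IH by (simp add: mult_ac)
qed

lemma power_le_fact_choose: "real (k + 1) ^ s \<le> fact s * real ((k + s) choose s)"
proof -
  have "(k + 1) ^ s * fact k \<le> fact (k + s)"
  proof (induction s)
    case (Suc s)
    have "(k + 1) ^ Suc s * fact k \<le> (k + 1) * fact (k + s)"
      using mult_le_mono2[OF Suc.IH, of "k+1"] by (simp add: mult_ac)
    also have "\<dots> \<le> fact (k + Suc s)" by simp
    finally show ?case .
  qed simp
  also have "fact (k + s) = fact s * fact k * ((k + s) choose s)"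
    using binomial_fact_lemma[of s "k + s"] by simp
  finally have "(k + 1) ^ s \<le> fact s * ((k + s) choose s)" by (simp add: mult_ac)
  then have "real ((k + 1) ^ s) \<le> real (fact s * ((k + s) choose s))" by (rule of_nat_mono)
  then show ?thesis by simp
qed

definition fps_geo :: "complex \<Rightarrow> complex fps" where
  "fps_geo b = Abs_fps (\<lambda>k. b ^ k)"

text \<open>
  The expansion of \<open>(1 - b \<lambda>)\<^sup>n\<^sup>+\<^sup>1 / (1 - r b \<lambda>)\<close>, the contribution of one linear factor \<open>1 - b \<lambda>\<close> of \<open>p\<close> to
  \<open>p\<^sup>n\<^sup>+\<^sup>1 / p\<^sub>r\<close>, where \<open>p\<^sub>r(\<lambda>) = p(r \<lambda>)\<close>.
\<close>

definition quot_factor :: "nat \<Rightarrow> real \<Rightarrow> complex \<Rightarrow> complex fps" where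
  "quot_factor n r b = (1 - fps_const b * fps_X) ^ (n + 1) * fps_geo (of_real r * b)"

lemma fps_one_minus_power_nth:
  "fps_nth ((1 - fps_const b * fps_X) ^ m) i = of_nat (m choose i) * (- b) ^ i" for b :: complex
proof -
  have "(1 - fps_const b * fps_X) ^ m = (fps_const (- b) * fps_X + 1) ^ m" by (simp flip: fps_const_neg)
  also have "\<dots> = (\<Sum>k\<le>m. of_nat (m choose k) * (fps_const (- b) * fps_X) ^ k * 1 ^ (m - k))"
    by (rule binomial_ring)
  also have "\<dots> = (\<Sum>k\<le>m. fps_const (of_nat (m choose k) * (- b) ^ k) * fps_X ^ k)"
    by (simp add: power_mult_distrib fps_const_power fps_of_nat[symmetric] mult.assoc[symmetric])
  finally show ?thesis
    by (simp add: fps_sum_nth fps_X_power_nth if_distrib binomial_eq_0 cong: if_cong)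
qed

lemma quot_factor_nth:
  "fps_nth (quot_factor n r b) k
    = b ^ k * of_real (\<Sum>i\<le>k. real ((n + 1) choose i) * (- 1) ^ i * r ^ (k - i))"
proof -
  have "fps_nth (quot_factor n r b) k = (\<Sum>i\<le>k. of_nat ((n + 1) choose i) * (- b) ^ i * (of_real r * b) ^ (k - i))"
    by (simp only: quot_factor_def fps_geo_def fps_mult_nth fps_one_minus_power_nth fps_nth_Abs_fps atLeast0AtMost)
  also have "\<dots> = (\<Sum>i\<le>k. b ^ k * (of_nat ((n + 1) choose i) * (- 1) ^ i * of_real r ^ (k - i)))"
  proof (rule sum.cong[OF refl])
    fix i assume "i \<in> {..k}"
    then have "b ^ k = b ^ i * b ^ (k - i)" by (simp flip: power_add)
    moreover have "(- b) ^ i = (- 1) ^ i * b ^ i" by (rule power_minus)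
    ultimately show "of_nat ((n + 1) choose i) * (- b) ^ i * (of_real r * b) ^ (k - i) = b ^ k * (of_nat ((n + 1) choose i) * (- 1) ^ i * of_real r ^ (k - i))"
      by (simp only: power_mult_distrib mult_ac)
  qed
  finally show ?thesis by (simp add: sum_distrib_left)
qed

lemma quot_factor_nth_low:
  assumes "cmod b \<le> 1" "0 \<le> r" "r \<le> 1"
  shows "cmod (fps_nth (quot_factor n r b) k) \<le> 2 ^ (n + 1)"
proof -
  have "cmod (fps_nth (quot_factor n r b) k) = cmod b ^ k * \<bar>\<Sum>i\<le>k. real ((n + 1) choose i) * (- 1) ^ i * r ^ (k - i)\<bar>"
    by (simp only: quot_factor_nth norm_mult norm_power norm_of_real)
  also have "\<dots> \<le> 1 * (\<Sum>i\<le>k. real ((n + 1) choose i))"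
  proof (intro mult_mono order.trans[OF sum_abs] sum_mono)
    fix i
    have "r ^ (k - i) \<le> 1" using assms by (intro power_le_one) auto
    then have "real ((n + 1) choose i) * r ^ (k - i) \<le> real ((n + 1) choose i) * 1" by (intro mult_left_mono) auto
    then show "\<bar>real ((n + 1) choose i) * (- 1) ^ i * r ^ (k - i)\<bar> \<le> real ((n + 1) choose i)"
      using assms by (simp add: abs_mult power_abs)
  qed (use assms in \<open>auto intro: power_le_one\<close>)
  also have "\<dots> \<le> 2 ^ (n + 1)"
  proof -
    have "(\<Sum>i\<le>k. (n + 1) choose i) \<le> (\<Sum>i\<le>max k (n + 1). (n + 1) choose i)"
      by (rule sum_mono2) auto
    also have "\<dots> = (\<Sum>i\<le>n + 1. (n + 1) choose i)"
      by (rule sum.mono_neutral_right) (auto intro: binomial_eq_0)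
    finally have "(\<Sum>i\<le>k. (n + 1) choose i) \<le> 2 ^ (n + 1)" by (simp only: choose_row_sum)
    then have "real (\<Sum>i\<le>k. (n + 1) choose i) \<le> real (2 ^ (n + 1))" by (rule of_nat_mono)
    then show ?thesis by simp
  qed
  finally show ?thesis .
qed

text \<open>
  Past the degree of the numerator the convolution contains the complete binomial sum for \<open>(r - 1)\<^sup>n\<^sup>+\<^sup>1\<close>. This
  cancellation as \<open>r \<rightarrow> 1\<close> is what makes the quotients bounded.
\<close>

lemma quot_factor_nth_high:
  assumes "cmod b \<le> 1" "0 \<le> r" "r \<le> 1"
  shows "cmod (fps_nth (quot_factor n r b) (k + (n + 1))) \<le> (1 - r) ^ (n + 1) * r ^ k"
proof -
  have "(\<Sum>i\<le>k + (n + 1). real ((n + 1) choose i) * (- 1) ^ i * r ^ (k + (n + 1) - i))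
      = (\<Sum>i\<le>n + 1. real ((n + 1) choose i) * (- 1) ^ i * r ^ (k + (n + 1) - i))"
    by (rule sum.mono_neutral_right) (auto intro: binomial_eq_0)
  also have "\<dots> = r ^ k * (\<Sum>i\<le>n + 1. real ((n + 1) choose i) * (- 1) ^ i * r ^ (n + 1 - i))"
    unfolding sum_distrib_left
  proof (rule sum.cong[OF refl])
    fix i assume "i \<in> {..n + 1}"
    then have "k + (n + 1) - i = k + (n + 1 - i)" by simp
    then show "real ((n + 1) choose i) * (- 1) ^ i * r ^ (k + (n + 1) - i) = r ^ k * (real ((n + 1) choose i) * (- 1) ^ i * r ^ (n + 1 - i))"
      by (simp only: power_add mult_ac)
  qed
  also have "(\<Sum>i\<le>n + 1. real ((n + 1) choose i) * (- 1) ^ i * r ^ (n + 1 - i)) = (- 1 + r) ^ (n + 1)"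
    by (rule binomial_ring[symmetric])
  finally have "cmod (fps_nth (quot_factor n r b) (k + (n + 1))) = cmod b ^ (k + (n + 1)) * (r ^ k * (1 - r) ^ (n + 1))"
    using assms by (simp only: quot_factor_nth norm_mult norm_power norm_of_real abs_mult power_abs) simp
  also have "\<dots> \<le> 1 * (r ^ k * (1 - r) ^ (n + 1))"
    using assms by (intro mult_right_mono power_le_one) auto
  finally show ?thesis by (simp add: mult_ac)
qed

lemma sum_split_shift_le:
  fixes f :: "nat \<Rightarrow> real"
  assumes "\<And>k. f k \<ge> 0"
  shows "(\<Sum>k\<le>K. f k) \<le> (\<Sum>k<m. f k) + (\<Sum>k\<le>K. f (k + m))"
proof -
  have "(\<Sum>k\<le>K. f k) \<le> (\<Sum>k<Suc K + m. f k)"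
    by (rule sum_mono2) (use assms in auto)
  also have "\<dots> = (\<Sum>k<m. f k) + (\<Sum>k<Suc K. f (k + m))"
    using sum.nat_group[of f] sum_up_index_split[of f] by (induction K) (simp_all add: add_ac)
  finally show ?thesis by (simp only: lessThan_Suc_atMost)
qed

lemma quot_factor_l1:
  assumes "cmod b \<le> 1" "0 \<le> r" "r \<le> 1"
  shows "l1_bounded (quot_factor n r b) (real (n + 1) * 2 ^ (n + 1) + 1)"
  unfolding l1_bounded_def
proof
  fix K
  let ?u = "\<lambda>k. cmod (fps_nth (quot_factor n r b) k)"
  have "(\<Sum>k\<le>K. ?u k) \<le> (\<Sum>k<n + 1. ?u k) + (\<Sum>k\<le>K. ?u (k + (n + 1)))"
    by (rule sum_split_shift_le) auto
  also have "(\<Sum>k<n + 1. ?u k) \<le> real (card {..<n + 1}) * 2 ^ (n + 1)"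
    by (intro sum_bounded_above quot_factor_nth_low assms)
  also have "(\<Sum>k\<le>K. ?u (k + (n + 1))) \<le> (\<Sum>k\<le>K. (1 - r) ^ (n + 1) * r ^ k)"
    by (intro sum_mono quot_factor_nth_high assms)
  also have "\<dots> = (1 - r) ^ n * ((1 - r) * (\<Sum>k\<le>K. r ^ k))"
    by (simp add: sum_distrib_left mult_ac)
  also have "\<dots> \<le> 1 * 1"
    using binomial_geometric_sum_le[of r 0 K] assms by (intro mult_mono power_le_one) (auto intro!: sum_nonneg mult_nonneg_nonneg)
  finally show "(\<Sum>k\<le>K. ?u k) \<le> real (n + 1) * 2 ^ (n + 1) + 1" by simp
qed

text \<open>
  The gain \<open>(1 - r)\<^sup>2\<^sup>n\<^sup>+\<^sup>2\<close> from the coefficients meets the growth \<open>(1 - r)\<^sup>-\<^sup>s\<^sup>-\<^sup>1\<close> of the weighted geometric series. They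
  balance uniformly in \<open>r\<close> precisely for \<open>s \<le> 2 n + 1\<close>, and this is where the exponent \<open>n\<close> of the theorem comes from.
\<close>

lemma quot_factor_l2:
  assumes "cmod b \<le> 1" "0 \<le> r" "r \<le> 1" and s: "s \<le> 2 * n + 1"
  shows "l2_bounded s (quot_factor n r b) (real (n + 1) * (real (n + 1) ^ s * (2 ^ (n + 1))\<^sup>2) + real (n + 2) ^ s * fact s)"
  unfolding l2_bounded_def
proof
  fix K
  let ?u = "\<lambda>k. real (k + 1) ^ s * (cmod (fps_nth (quot_factor n r b) k))\<^sup>2"
  have "(\<Sum>k\<le>K. ?u k) \<le> (\<Sum>k<n + 1. ?u k) + (\<Sum>k\<le>K. ?u (k + (n + 1)))"
    by (rule sum_split_shift_le) auto
  also have "(\<Sum>k<n + 1. ?u k) \<le> real (card {..<n + 1}) * (real (n + 1) ^ s * (2 ^ (n + 1))\<^sup>2)"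
    by (intro sum_bounded_above mult_mono power_mono quot_factor_nth_low assms) auto
  also have "(\<Sum>k\<le>K. ?u (k + (n + 1))) \<le> (\<Sum>k\<le>K. real (n + 2) ^ s * fact s * (1 - r) ^ Suc s * (real ((k + s) choose s) * r ^ k))"
  proof (intro sum_mono)
    fix k
    have "real (k + (n + 1) + 1) \<le> real (n + 2) * real (k + 1)" by (simp add: algebra_simps)
    then have "real (k + (n + 1) + 1) ^ s \<le> (real (n + 2) * real (k + 1)) ^ s" by (intro power_mono) auto
    also have "\<dots> \<le> real (n + 2) ^ s * (fact s * real ((k + s) choose s))"
      unfolding power_mult_distrib by (intro mult_left_mono power_le_fact_choose) auto
    finally have 1: "real (k + (n + 1) + 1) ^ s \<le> real (n + 2) ^ s * (fact s * real ((k + s) choose s))" .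
    have "(cmod (fps_nth (quot_factor n r b) (k + (n + 1))))\<^sup>2 \<le> ((1 - r) ^ (n + 1) * r ^ k)\<^sup>2"
      by (intro power_mono quot_factor_nth_high assms) auto
    also have "\<dots> = (1 - r) ^ ((n + 1) * 2) * r ^ (k * 2)"
      by (simp only: power_mult_distrib power_mult)
    also have "\<dots> \<le> (1 - r) ^ Suc s * r ^ k"
      using assms by (intro mult_mono power_decreasing) auto
    finally have 2: "(cmod (fps_nth (quot_factor n r b) (k + (n + 1))))\<^sup>2 \<le> (1 - r) ^ Suc s * r ^ k" .
    have "?u (k + (n + 1)) \<le> (real (n + 2) ^ s * (fact s * real ((k + s) choose s))) * ((1 - r) ^ Suc s * r ^ k)"
      by (intro mult_mono 1 2) auto
    then show "?u (k + (n + 1)) \<le> real (n + 2) ^ s * fact s * (1 - r) ^ Suc s * (real ((k + s) choose s) * r ^ k)"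
      by (simp only: mult_ac)
  qed
  also have "\<dots> = real (n + 2) ^ s * fact s * ((1 - r) ^ Suc s * (\<Sum>k\<le>K. real ((k + s) choose s) * r ^ k))"
    by (simp only: sum_distrib_left mult.assoc)
  also have "\<dots> \<le> real (n + 2) ^ s * fact s * 1"
    by (intro mult_left_mono binomial_geometric_sum_le assms) auto
  finally show "(\<Sum>k\<le>K. ?u k) \<le> real (n + 1) * (real (n + 1) ^ s * (2 ^ (n + 1))\<^sup>2) + real (n + 2) ^ s * fact s" by simp
qed

lemma quot_product_bounded:
  assumes s: "s \<le> 2 * n + 1"
  shows "\<exists>C1 C2. \<forall>r bs. 0 \<le> r \<longrightarrow> r \<le> 1 \<longrightarrow> length bs \<le> m \<longrightarrow> (\<forall>b\<in>set bs. cmod b \<le> 1) \<longrightarrow>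
    l1_bounded (\<Prod>b\<leftarrow>bs. quot_factor n r b) C1 \<and> l2_bounded s (\<Prod>b\<leftarrow>bs. quot_factor n r b) C2"
proof (induction m)
  case 0
  have "cmod (fps_nth 1 k) = (if k = 0 then 1 else 0)"
    "real (k + 1) ^ s * (cmod (fps_nth 1 k))\<^sup>2 = (if k = 0 then 1 else 0)" for k
    by auto
  then have "l1_bounded 1 1" "l2_bounded s 1 1"
    unfolding l1_bounded_def l2_bounded_def by (simp_all only: sum.delta finite_atMost) auto
  then show ?case by (intro exI[of _ 1]) auto
next
  case (Suc m)
  then obtain C1 C2 where C: "\<And>r bs. 0 \<le> r \<Longrightarrow> r \<le> 1 \<Longrightarrow> length bs \<le> m \<Longrightarrow> (\<forall>b\<in>set bs. cmod b \<le> 1) \<Longrightarrow>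
    l1_bounded (\<Prod>b\<leftarrow>bs. quot_factor n r b) C1 \<and> l2_bounded s (\<Prod>b\<leftarrow>bs. quot_factor n r b) C2" by blast
  define A1 where "A1 = real (n + 1) * 2 ^ (n + 1) + 1"
  define A2 where "A2 = real (n + 1) * (real (n + 1) ^ s * (2 ^ (n + 1))\<^sup>2) + real (n + 2) ^ s * fact s"
  define D1 where "D1 = max C1 (A1 * C1)"
  define D2 where "D2 = max C2 (2 ^ (s + 1) * (A2 * C1\<^sup>2 + C2 * A1\<^sup>2))"
  have mono1: "l1_bounded F x \<Longrightarrow> x \<le> y \<Longrightarrow> l1_bounded F y" for F x y
    unfolding l1_bounded_def using order.trans by blast
  have mono2: "l2_bounded s F x \<Longrightarrow> x \<le> y \<Longrightarrow> l2_bounded s F y" for F x y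
    unfolding l2_bounded_def using order.trans by blast
  have "l1_bounded (\<Prod>b\<leftarrow>bs. quot_factor n r b) D1 \<and> l2_bounded s (\<Prod>b\<leftarrow>bs. quot_factor n r b) D2"
    if *: "0 \<le> r" "r \<le> 1" "length bs \<le> Suc m" "\<forall>b\<in>set bs. cmod b \<le> 1" for r bs
  proof (cases bs)
    case Nil
    then have "l1_bounded (\<Prod>b\<leftarrow>bs. quot_factor n r b) C1 \<and> l2_bounded s (\<Prod>b\<leftarrow>bs. quot_factor n r b) C2"
      by (intro C *) auto
    then show ?thesis by (auto simp: D1_def D2_def intro: mono1 mono2)
  next
    case (Cons b bs')
    have IH: "l1_bounded (\<Prod>b\<leftarrow>bs'. quot_factor n r b) C1" "l2_bounded s (\<Prod>b\<leftarrow>bs'. quot_factor n r b) C2"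
      using C[of r bs'] * Cons by auto
    have b: "l1_bounded (quot_factor n r b) A1" "l2_bounded s (quot_factor n r b) A2"
      unfolding A1_def A2_def using * Cons s by (auto intro!: quot_factor_l1[simplified] quot_factor_l2[simplified])
    have "l1_bounded (\<Prod>b\<leftarrow>bs. quot_factor n r b) (A1 * C1)"
      unfolding Cons list.map prod_list.Cons by (rule l1_bounded_mult[OF b(1) IH(1)])
    moreover have "l2_bounded s (\<Prod>b\<leftarrow>bs. quot_factor n r b) (2 ^ (s + 1) * (A2 * C1\<^sup>2 + C2 * A1\<^sup>2))"
      unfolding Cons list.map prod_list.Cons by (rule l2_bounded_mult[OF b IH])
    ultimately show ?thesis by (auto simp: D1_def D2_def intro: mono1 mono2)
  qed
  then show ?case by blast
qed


section \<open>Stable polynomials of one variable\<close>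

text \<open>
  The numbers \<open>b\<close> are the reciprocals of the roots.
\<close>

lemma poly_disc_factorization:
  fixes P :: "complex poly"
  assumes "\<And>x. cmod x < 1 \<Longrightarrow> poly P x \<noteq> 0"
  shows "\<exists>bs. length bs \<le> degree P \<and> (\<forall>b\<in>set bs. cmod b \<le> 1) \<and> P = smult (poly P 0) (\<Prod>b\<leftarrow>bs. [:1, - b:])"
  using assms
proof (induction "degree P" arbitrary: P)
  case 0
  then obtain a where "P = [:a:]" by (metis degree_eq_zeroE)
  then show ?case by (intro exI[of _ "[]"]) auto
next
  case (Suc k)
  have "\<not> constant (poly P)" using Suc.hyps by (simp add: constant_degree)
  then obtain a where a: "poly P a = 0" using fundamental_theorem_of_algebra by blast
  then have a1: "cmod a \<ge> 1" using Suc.prems by force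
  then have a0: "a \<noteq> 0" by auto
  obtain Q where Q: "P = [:- a, 1:] * Q" using a by (metis poly_eq_0_iff_dvd dvdE)
  define R where "R = smult (- a) Q"
  have "[:- a, 1:] = smult (- a) [:1, - (1 / a):]" using a0 by simp
  then have P: "P = [:1, - (1 / a):] * R" by (simp only: Q R_def mult_smult_left mult_smult_right)
  have "R \<noteq> 0" using P Suc.hyps by auto
  then have "degree P = 1 + degree R" unfolding P using a0 by (subst degree_mult_eq) auto
  then have deg: "k = degree R" using Suc.hyps by simp
  have "poly R x \<noteq> 0" if "cmod x < 1" for x using Suc.prems[OF that] P by auto
  then obtain bs where bs: "length bs \<le> degree R" "\<forall>b\<in>set bs. cmod b \<le> 1" "R = smult (poly R 0) (\<Prod>b\<leftarrow>bs. [:1, - b:])"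
    using Suc.hyps(1)[OF deg] by blast
  have "poly P 0 = poly R 0" by (simp add: P)
  have "P = smult (poly P 0) (\<Prod>b\<leftarrow>(1 / a) # bs. [:1, - b:])"
    unfolding list.map prod_list.Cons \<open>poly P 0 = poly R 0\<close> mult_smult_right[symmetric] bs(3)[symmetric] by (rule P)
  moreover have "cmod (1 / a) \<le> 1" using a1 a0 by (simp add: norm_divide field_simps)
  moreover have "length ((1 / a) # bs) \<le> degree P" using bs(1) deg Suc.hyps(2) by simp
  ultimately show ?case using bs(2) by (intro exI[of _ "(1 / a) # bs"] conjI) simp_all
qed

definition fps_dilate :: "real \<Rightarrow> complex fps \<Rightarrow> complex fps" where
  "fps_dilate r F = Abs_fps (\<lambda>k. of_real r ^ k * fps_nth F k)"

lemma fps_dilate_mult: "fps_dilate r (F * G) = fps_dilate r F * fps_dilate r G"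
proof (rule fps_ext)
  fix k
  have "of_real r ^ k * (fps_nth F i * fps_nth G (k - i)) = (of_real r ^ i * fps_nth F i) * (of_real r ^ (k - i) * fps_nth G (k - i))"
    if "i \<in> {0..k}" for i
  proof -
    have "(of_real r :: complex) ^ k = of_real r ^ i * of_real r ^ (k - i)" using that by (simp flip: power_add)
    then show ?thesis by simp
  qed
  then show "fps_nth (fps_dilate r (F * G)) k = fps_nth (fps_dilate r F * fps_dilate r G) k"
    unfolding fps_dilate_def fps_mult_nth fps_nth_Abs_fps sum_distrib_left by (rule sum.cong[OF refl])
qed

lemma fps_dilate_const [simp]: "fps_dilate r (fps_const c) = fps_const c"
  by (rule fps_ext) (simp add: fps_dilate_def)

lemma fps_dilate_prod_list: "fps_dilate r (\<Prod>b\<leftarrow>bs. f b) = (\<Prod>b\<leftarrow>bs. fps_dilate r (f b))"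
  using fps_dilate_const[of r 1] by (induction bs) (auto simp: fps_dilate_mult)

lemma fps_geo_inverse: "(1 - fps_const b * fps_X) * fps_geo b = 1"
proof (rule fps_ext)
  fix k
  show "fps_nth ((1 - fps_const b * fps_X) * fps_geo b) k = fps_nth 1 k"
    by (cases k) (simp_all add: fps_geo_def left_diff_distrib mult.assoc)
qed

lemma fps_of_poly_factors:
  fixes c :: complex
  shows "fps_of_poly (smult c (\<Prod>b\<leftarrow>bs. [:1, - b:])) = fps_const c * (\<Prod>b\<leftarrow>bs. 1 - fps_const b * fps_X)"
proof -
  have lin: "fps_of_poly [:1, - b:] = 1 - fps_const b * fps_X" for b :: complex
    by (simp add: fps_of_poly_linear' flip: fps_const_neg)
  show ?thesis by (simp only: fps_of_poly_smult fps_of_poly_prod_list map_map o_def lin)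
qed

lemma inverse_fps_of_poly_factors:
  assumes "c \<noteq> 0"
  shows "inverse (fps_of_poly (smult c (\<Prod>b\<leftarrow>bs. [:1, - b:]))) = fps_const (1 / c) * (\<Prod>b\<leftarrow>bs. fps_geo b)"
proof -
  have "(\<Prod>b\<leftarrow>bs. 1 - fps_const b * fps_X) * (\<Prod>b\<leftarrow>bs. fps_geo b) = 1"
  proof (induction bs)
    case (Cons b bs)
    have "(\<Prod>b\<leftarrow>b # bs. 1 - fps_const b * fps_X) * (\<Prod>b\<leftarrow>b # bs. fps_geo b)
      = ((1 - fps_const b * fps_X) * fps_geo b) * ((\<Prod>b\<leftarrow>bs. 1 - fps_const b * fps_X) * (\<Prod>b\<leftarrow>bs. fps_geo b))"
      by (simp only: list.map prod_list.Cons mult_ac)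
    then show ?case using Cons fps_geo_inverse by simp
  qed simp
  then have "fps_of_poly (smult c (\<Prod>b\<leftarrow>bs. [:1, - b:])) * (fps_const (1 / c) * (\<Prod>b\<leftarrow>bs. fps_geo b)) = fps_const c * fps_const (1 / c) * 1"
    unfolding fps_of_poly_factors by (simp only: mult_ac)
  also have "\<dots> = 1" using assms by simp
  finally show ?thesis using fps_inverse_unique by metis
qed

text \<open>
  The coefficients of the dilated inverse are those of \<open>1 / P(r \<lambda>)\<close>, so that the left-hand side is
  \<open>P(\<lambda>)\<^sup>n\<^sup>+\<^sup>1 / P(r \<lambda>)\<close>.
\<close>

lemma dilated_quotient_factors:
  assumes "c \<noteq> 0" and P: "P = smult c (\<Prod>b\<leftarrow>bs. [:1, - b:])"
  shows "fps_dilate r (inverse (fps_of_poly P)) * fps_of_poly P ^ (n + 1) = fps_const (c ^ n) * (\<Prod>b\<leftarrow>bs. quot_factor n r b)"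
proof -
  have "fps_dilate r (fps_geo b) = fps_geo (of_real r * b)" for b
    by (simp add: fps_dilate_def fps_geo_def power_mult_distrib)
  then have "fps_dilate r (inverse (fps_of_poly P)) = fps_const (1 / c) * (\<Prod>b\<leftarrow>bs. fps_geo (of_real r * b))"
    unfolding P inverse_fps_of_poly_factors[OF assms(1)] by (simp add: fps_dilate_mult fps_dilate_prod_list)
  moreover have "(\<Prod>b\<leftarrow>bs. fps_geo (of_real r * b)) * (\<Prod>b\<leftarrow>bs. 1 - fps_const b * fps_X) ^ (n + 1) = (\<Prod>b\<leftarrow>bs. quot_factor n r b)"
  proof (induction bs)
    case (Cons b bs)
    have "(\<Prod>b\<leftarrow>b # bs. fps_geo (of_real r * b)) * (\<Prod>b\<leftarrow>b # bs. 1 - fps_const b * fps_X) ^ (n + 1)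
        = ((1 - fps_const b * fps_X) ^ (n + 1) * fps_geo (of_real r * b)) *
          ((\<Prod>b\<leftarrow>bs. fps_geo (of_real r * b)) * (\<Prod>b\<leftarrow>bs. 1 - fps_const b * fps_X) ^ (n + 1))"
      by (simp only: list.map prod_list.Cons power_mult_distrib mult_ac)
    then show ?case unfolding Cons by (simp only: quot_factor_def[of n r b] list.map prod_list.Cons)
  qed simp
  moreover have "fps_const (1 / c) * fps_const c ^ (n + 1) = fps_const (c ^ n)"
    using assms(1) by (simp add: fps_const_power)
  ultimately show ?thesis
    unfolding P fps_of_poly_factors power_mult_distrib by (metis (no_types, lifting) mult.assoc mult.left_commute)
qed

lemma fps_geo_prod_nth_le:
  assumes "\<forall>b\<in>set bs. cmod b \<le> 1" "length bs \<le> m"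
  shows "cmod (fps_nth (\<Prod>b\<leftarrow>bs. fps_geo b) k) \<le> real (k + 1) ^ m"
  using assms
proof (induction bs arbitrary: k m)
  case Nil
  have "1 \<le> real (k + 1) ^ m" by (rule one_le_power) simp
  then show ?case by simp
next
  case (Cons b bs)
  then obtain m' where m': "m = Suc m'" "length bs \<le> m'" by (cases m) auto
  have "cmod (fps_nth (\<Prod>b\<leftarrow>b # bs. fps_geo b) k) \<le> (\<Sum>i\<le>k. cmod (fps_nth (fps_geo b) i) * cmod (fps_nth (\<Prod>b\<leftarrow>bs. fps_geo b) (k - i)))"
    unfolding list.map prod_list.Cons by (rule cmod_fps_mult_nth_le)
  also have "\<dots> \<le> (\<Sum>i\<le>k. 1 * real (k + 1) ^ m')"
  proof (intro sum_mono mult_mono)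
    fix i assume "i \<in> {..k}"
    have "cmod (fps_nth (\<Prod>b\<leftarrow>bs. fps_geo b) (k - i)) \<le> real (k - i + 1) ^ m'"
      using Cons m' by auto
    also have "\<dots> \<le> real (k + 1) ^ m'" by (intro power_mono) auto
    finally show "cmod (fps_nth (\<Prod>b\<leftarrow>bs. fps_geo b) (k - i)) \<le> real (k + 1) ^ m'" .
  qed (use Cons in \<open>auto simp: fps_geo_def norm_power intro: power_le_one\<close>)
  also have "\<dots> = real (k + 1) ^ m" by (simp add: m')
  finally show ?case .
qed

lemma l1_bounded_power:
  assumes "l1_bounded F A"
  shows "l1_bounded (F ^ j) (A ^ j)"
proof (induction j)
  case 0
  have "cmod (fps_nth 1 k) = (if k = 0 then 1 else 0)" for k by auto
  then show ?case unfolding l1_bounded_def by (simp only: power_0 sum.delta finite_atMost) auto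
qed (simp add: l1_bounded_mult assms)

lemma l1_bounded_factors:
  assumes "\<forall>b\<in>set bs. cmod b \<le> 1" "length bs \<le> m"
  shows "l1_bounded (fps_const c * (\<Prod>b\<leftarrow>bs. 1 - fps_const b * fps_X)) (cmod c * 2 ^ m)"
  using assms
proof (induction bs arbitrary: m)
  case Nil
  have "cmod (fps_nth (fps_const c) k) = (if k = 0 then cmod c else 0)" for k by auto
  then have "(\<Sum>k\<le>K. cmod (fps_nth (fps_const c) k)) = cmod c" for K
    by (simp only: sum.delta finite_atMost) auto
  moreover have "cmod c * 1 \<le> cmod c * 2 ^ m" by (intro mult_left_mono) auto
  ultimately show ?case by (simp add: l1_bounded_def)
next
  case (Cons b bs)
  then obtain m' where m': "m = Suc m'" "length bs \<le> m'" by (cases m) auto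
  have "l1_bounded (1 - fps_const b * fps_X) 2"
    unfolding l1_bounded_def
  proof
    fix K
    have "(\<Sum>k\<le>K. cmod (fps_nth (1 - fps_const b * fps_X) k)) \<le> (\<Sum>k\<le>K. (if k = 0 then 1 else 0) + (if k = 1 then 1 else 0))"
      using Cons by (intro sum_mono) (auto simp: fps_X_def)
    also have "\<dots> \<le> 2" unfolding sum.distrib by (simp only: sum.delta finite_atMost) auto
    finally show "(\<Sum>k\<le>K. cmod (fps_nth (1 - fps_const b * fps_X) k)) \<le> 2" .
  qed
  then have "l1_bounded ((1 - fps_const b * fps_X) * (fps_const c * (\<Prod>b\<leftarrow>bs. 1 - fps_const b * fps_X))) (2 * (cmod c * 2 ^ m'))"
    using Cons.prems m'(2) by (intro l1_bounded_mult[OF _ Cons.IH]) auto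
  then show ?case by (simp add: m' mult_ac)
qed

lemma power_geometric_tendsto_0:
  fixes x :: real
  assumes "0 \<le> x" "x < 1"
  shows "(\<lambda>k. real (k + 1) ^ t * x ^ k) \<longlonglongrightarrow> 0"
proof (rule summable_LIMSEQ_zero, rule summableI_nonneg_bounded)
  fix K
  have "(\<Sum>k<K. real (k + 1) ^ t * x ^ k) \<le> (\<Sum>k\<le>K. real (k + 1) ^ t * x ^ k)"
    by (rule sum_mono2) (use assms in auto)
  also have "\<dots> \<le> (\<Sum>k\<le>K. fact t * real ((k + t) choose t) * x ^ k)"
    by (intro sum_mono mult_right_mono power_le_fact_choose) (use assms in auto)
  also have "\<dots> = fact t * (\<Sum>k\<le>K. real ((k + t) choose t) * x ^ k)"
    by (simp add: sum_distrib_left mult.assoc)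
  also have "\<dots> \<le> fact t * (1 / (1 - x) ^ Suc t)"
    using binomial_geometric_sum_le[of x t K] assms by (intro mult_left_mono) (auto simp: field_simps)
  finally show "(\<Sum>k<K. real (k + 1) ^ t * x ^ k) \<le> fact t * (1 / (1 - x) ^ Suc t)" .
qed (use assms in auto)

text \<open>
  The degree bound \<open>m\<close> and the constant term \<open>c\<close> are recorded because estimates have to be uniform over all
  restrictions of one polynomial of several variables to lines: these share \<open>m\<close> and \<open>c\<close>, whereas the actual degree
  may drop.
\<close>

definition disc_stable :: "nat \<Rightarrow> complex \<Rightarrow> complex poly \<Rightarrow> bool" where
  "disc_stable m c P \<longleftrightarrow> degree P \<le> m \<and> poly P 0 = c \<and> (\<forall>x. cmod x < 1 \<longrightarrow> poly P x \<noteq> 0)"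

text \<open>
  The polynomial of degree at most \<open>K\<close> whose coefficients are the first ones of \<open>1 / P(r \<lambda>)\<close>.
\<close>

definition inverse_poly :: "real \<Rightarrow> nat \<Rightarrow> complex poly \<Rightarrow> complex poly" where
  "inverse_poly r K P = (\<Sum>k\<le>K. monom (of_real r ^ k * fps_nth (inverse (fps_of_poly P)) k) k)"

lemma coeff_inverse_poly:
  "coeff (inverse_poly r K P) k = (if k \<le> K then of_real r ^ k * fps_nth (inverse (fps_of_poly P)) k else 0)"
  by (simp add: inverse_poly_def coeff_sum)

lemma coeff_inverse_poly_mult_low:
  assumes "k \<le> K"
  shows "coeff (inverse_poly r K P * G) k = fps_nth (fps_dilate r (inverse (fps_of_poly P)) * fps_of_poly G) k"
  unfolding coeff_mult fps_mult_nth atLeast0AtMost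
  by (rule sum.cong) (use assms in \<open>auto simp: coeff_inverse_poly fps_dilate_def\<close>)

text \<open>
  Truncation spoils only the \<open>m (n + 1)\<close> coefficients that follow the first \<open>K + 1\<close>. In these, every
  non-vanishing term involves a coefficient of \<open>1 / P(r \<lambda>)\<close> whose index is at least \<open>J\<close>; the coefficients of
  \<open>1 / P\<close> grow at most like \<open>k\<^sup>m\<close>, and the dilation contributes the factor \<open>r\<^sup>J\<close>.
\<close>

lemma coeff_inverse_poly_mult_high:
  assumes P: "disc_stable m c P" and r: "0 \<le> r" "r \<le> 1" and k: "m * (n + 1) + J < k"
  shows "cmod (coeff (inverse_poly r (m * (n + 1) + J) P * P ^ (n + 1)) k)
    \<le> (cmod c * 2 ^ m) ^ (n + 1) / cmod c * real (m * (n + 1) + J + 1) ^ m * r ^ J"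
proof -
  let ?K = "m * (n + 1) + J"
  obtain bs where bs: "length bs \<le> degree P" "\<forall>b\<in>set bs. cmod b \<le> 1" "P = smult c (\<Prod>b\<leftarrow>bs. [:1, - b:])"
    using poly_disc_factorization[of P] P unfolding disc_stable_def by blast
  have len: "length bs \<le> m" and deg: "degree P \<le> m" using bs P by (auto simp: disc_stable_def)
  have c0: "c \<noteq> 0" using P unfolding disc_stable_def by fastforce
  let ?q = "1 / cmod c * real (?K + 1) ^ m * r ^ J"
  have l1: "l1_bounded (fps_of_poly P ^ (n + 1)) ((cmod c * 2 ^ m) ^ (n + 1))"
    unfolding bs(3) fps_of_poly_factors by (intro l1_bounded_power l1_bounded_factors bs len)
  have "degree (P ^ (n + 1)) \<le> degree P * (n + 1)" by (rule degree_power_le)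
  also have "\<dots> \<le> m * (n + 1)" using deg by (rule mult_le_mono1)
  finally have degn: "degree (P ^ (n + 1)) \<le> m * (n + 1)" .
  have "cmod (coeff (inverse_poly r ?K P * P ^ (n + 1)) k)
    \<le> (\<Sum>i\<le>k. cmod (coeff (P ^ (n + 1)) i) * cmod (coeff (inverse_poly r ?K P) (k - i)))"
    unfolding mult.commute[of "inverse_poly r ?K P"] coeff_mult by (rule sum_norm_le) (simp add: norm_mult)
  also have "\<dots> \<le> (\<Sum>i\<le>k. cmod (coeff (P ^ (n + 1)) i) * ?q)"
  proof (rule sum_mono)
    fix i assume i: "i \<in> {..k}"
    show "cmod (coeff (P ^ (n + 1)) i) * cmod (coeff (inverse_poly r ?K P) (k - i)) \<le> cmod (coeff (P ^ (n + 1)) i) * ?q"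
    proof (cases "i \<le> m * (n + 1) \<and> k - i \<le> ?K")
      case False
      then have "coeff (P ^ (n + 1)) i = 0 \<or> coeff (inverse_poly r ?K P) (k - i) = 0"
        using degn by (auto simp: coeff_inverse_poly intro: coeff_eq_0)
      then show ?thesis using r by auto
    next
      case True
      then have J: "J \<le> k - i" using k by linarith
      have "cmod (coeff (inverse_poly r ?K P) (k - i)) = r ^ (k - i) * (1 / cmod c * cmod (fps_nth (\<Prod>b\<leftarrow>bs. fps_geo b) (k - i)))"
        using True r unfolding coeff_inverse_poly bs(3) inverse_fps_of_poly_factors[OF c0]
        by (simp add: norm_mult norm_power norm_divide)
      also have "\<dots> \<le> r ^ J * (1 / cmod c * real (?K + 1) ^ m)"
      proof (intro mult_mono power_decreasing J r)
        have "cmod (fps_nth (\<Prod>b\<leftarrow>bs. fps_geo b) (k - i)) \<le> real (k - i + 1) ^ m"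
          by (rule fps_geo_prod_nth_le) (use bs len in auto)
        also have "\<dots> \<le> real (?K + 1) ^ m" using True by (intro power_mono of_nat_mono) auto
        finally show "cmod (fps_nth (\<Prod>b\<leftarrow>bs. fps_geo b) (k - i)) \<le> real (?K + 1) ^ m" .
      qed (use r in auto)
      finally show ?thesis by (intro mult_left_mono) (simp_all add: mult_ac)
    qed
  qed
  also have "\<dots> = (\<Sum>i\<le>k. cmod (fps_nth (fps_of_poly P ^ (n + 1)) i)) * ?q"
    by (simp only: sum_distrib_right fps_of_poly_nth flip: fps_of_poly_power)
  also have "\<dots> \<le> (cmod c * 2 ^ m) ^ (n + 1) * ?q"
    using l1 r by (intro mult_right_mono) (auto simp: l1_bounded_def)
  finally show ?thesis by (simp only: times_divide_eq_left times_divide_eq_right mult.assoc mult_1_left)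
qed

text \<open>
  For coefficients up to index \<open>K\<close> the bound is the one for \<open>P(\<lambda>)\<^sup>n\<^sup>+\<^sup>1 / P(r \<lambda>)\<close>. For fixed \<open>r < 1\<close> the remaining coefficients
  contribute at most \<open>1\<close> as soon as \<open>K\<close> is large. The constant \<open>C\<close> depends neither on \<open>r\<close> nor on \<open>P\<close>.
\<close>

lemma truncated_quotient_bound:
  assumes s: "s \<le> 2 * n + 1"
  shows "\<exists>C. \<forall>r N. 0 \<le> r \<longrightarrow> r < 1 \<longrightarrow> (\<exists>K\<ge>N. \<forall>P. disc_stable m c P \<longrightarrow>
    (\<Sum>k\<le>K + m * (n + 1). real (k + 1) ^ s * (cmod (coeff (inverse_poly r K P * P ^ (n + 1)) k))\<^sup>2) \<le> C)"
proof -
  obtain C2 where C2: "\<And>r bs. 0 \<le> r \<Longrightarrow> r \<le> 1 \<Longrightarrow> length bs \<le> m \<Longrightarrow> (\<forall>b\<in>set bs. cmod b \<le> 1) \<Longrightarrow>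
      l2_bounded s (\<Prod>b\<leftarrow>bs. quot_factor n r b) C2"
    using quot_product_bounded[OF s, of m] by blast
  define C where "C = (cmod c ^ n)\<^sup>2 * C2 + 1"
  have "\<exists>K\<ge>N. \<forall>P. disc_stable m c P \<longrightarrow>
    (\<Sum>k\<le>K + m * (n + 1). real (k + 1) ^ s * (cmod (coeff (inverse_poly r K P * P ^ (n + 1)) k))\<^sup>2) \<le> C"
    if r: "0 \<le> r" "r < 1" for r N
  proof -
    define M where "M = m * (n + 1)"
    define L where "L = (cmod c * 2 ^ m) ^ (n + 1) / cmod c"
    define B where "B = real M * L\<^sup>2 * real (2 * M + 1) ^ (s + 2 * m)"
    have B: "B \<ge> 0" by (simp add: B_def)
    have r2: "0 \<le> r\<^sup>2" "r\<^sup>2 < 1" using r by (auto simp: abs_square_less_1)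
    have "(\<lambda>J. B * (real (J + 1) ^ (s + 2 * m) * (r\<^sup>2) ^ J)) \<longlonglongrightarrow> B * 0"
      by (intro tendsto_mult_left power_geometric_tendsto_0 r2)
    then have "\<forall>\<^sub>F J in sequentially. B * (real (J + 1) ^ (s + 2 * m) * (r\<^sup>2) ^ J) < 1"
      by (rule order_tendstoD) simp
    then obtain J where J: "J \<ge> N" "B * (real (J + 1) ^ (s + 2 * m) * (r\<^sup>2) ^ J) < 1"
      unfolding eventually_sequentially by (meson nle_le order_refl)
    let ?K = "M + J"
    have "(\<Sum>k\<le>?K + M. real (k + 1) ^ s * (cmod (coeff (inverse_poly r ?K P * P ^ (n + 1)) k))\<^sup>2) \<le> C"
      if P: "disc_stable m c P" for P
    proof -
      let ?a = "\<lambda>k. real (k + 1) ^ s * (cmod (coeff (inverse_poly r ?K P * P ^ (n + 1)) k))\<^sup>2"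
      obtain bs where bs: "length bs \<le> degree P" "\<forall>b\<in>set bs. cmod b \<le> 1" "P = smult c (\<Prod>b\<leftarrow>bs. [:1, - b:])"
        using poly_disc_factorization[of P] P unfolding disc_stable_def by blast
      have c0: "c \<noteq> 0" using P unfolding disc_stable_def by fastforce
      have "(\<Sum>k\<le>?K. ?a k) = (cmod c ^ n)\<^sup>2 * (\<Sum>k\<le>?K. real (k + 1) ^ s * (cmod (fps_nth (\<Prod>b\<leftarrow>bs. quot_factor n r b) k))\<^sup>2)"
        unfolding sum_distrib_left
      proof (rule sum.cong[OF refl])
        fix k assume "k \<in> {..?K}"
        then have "coeff (inverse_poly r ?K P * P ^ (n + 1)) k = c ^ n * fps_nth (\<Prod>b\<leftarrow>bs. quot_factor n r b) k"
          by (simp only: coeff_inverse_poly_mult_low atMost_iff fps_of_poly_power dilated_quotient_factors[OF c0 bs(3)] fps_mult_left_const_nth)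
        then show "?a k = (cmod c ^ n)\<^sup>2 * (real (k + 1) ^ s * (cmod (fps_nth (\<Prod>b\<leftarrow>bs. quot_factor n r b) k))\<^sup>2)"
          by (simp only: norm_mult norm_power power_mult_distrib mult_ac)
      qed
      also have "\<dots> \<le> (cmod c ^ n)\<^sup>2 * C2"
        using C2[of r bs] r bs P unfolding l2_bounded_def disc_stable_def by (intro mult_left_mono) auto
      finally have low: "(\<Sum>k\<le>?K. ?a k) \<le> (cmod c ^ n)\<^sup>2 * C2" .
      have mono: "real (J + x + 1) \<le> real (x + 1) * real (J + 1)" for x
        by (simp add: algebra_simps)
      have "(\<Sum>k\<in>{?K<..?K + M}. ?a k) \<le> real (card {?K<..?K + M}) * (real (?K + M + 1) ^ s * (L * real (?K + 1) ^ m * r ^ J)\<^sup>2)"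
      proof (rule sum_bounded_above)
        fix k assume k: "k \<in> {?K<..?K + M}"
        have "cmod (coeff (inverse_poly r ?K P * P ^ (n + 1)) k) \<le> L * real (?K + 1) ^ m * r ^ J"
          unfolding M_def L_def by (rule coeff_inverse_poly_mult_high[OF P]) (use r k in \<open>auto simp: M_def\<close>)
        moreover have "k + 1 \<le> ?K + M + 1" using k by simp
        ultimately show "?a k \<le> real (?K + M + 1) ^ s * (L * real (?K + 1) ^ m * r ^ J)\<^sup>2"
          by (intro mult_mono power_mono of_nat_mono) auto
      qed
      also have "\<dots> = real M * L\<^sup>2 * (real (J + 2 * M + 1) ^ s * real (J + M + 1) ^ (2 * m) * (r\<^sup>2) ^ J)"
        by (simp add: power_mult_distrib power_mult[symmetric] mult_ac add_ac mult_2)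
      also have "\<dots> \<le> real M * L\<^sup>2 * ((real (2 * M + 1) * real (J + 1)) ^ s * (real (2 * M + 1) * real (J + 1)) ^ (2 * m) * (r\<^sup>2) ^ J)"
      proof (intro mult_left_mono mult_right_mono mult_mono power_mono mono)
        show "real (J + M + 1) \<le> real (2 * M + 1) * real (J + 1)"
          using mono[of "2 * M"] by linarith
      qed auto
      also have "\<dots> = B * (real (J + 1) ^ (s + 2 * m) * (r\<^sup>2) ^ J)"
        unfolding B_def by (simp only: power_mult_distrib power_add mult_ac)
      finally have high: "(\<Sum>k\<in>{?K<..?K + M}. ?a k) \<le> 1" using J(2) by linarith
      have "{..?K + M} = {..?K} \<union> {?K<..?K + M}" by auto
      then have "(\<Sum>k\<le>?K + M. ?a k) = (\<Sum>k\<le>?K. ?a k) + (\<Sum>k\<in>{?K<..?K + M}. ?a k)"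
        by (simp only:) (rule sum.union_disjoint; auto)
      then show ?thesis using low high unfolding C_def by linarith
    qed
    then show ?thesis using J(1) unfolding M_def by (intro exI[of _ "m * (n + 1) + J"]) auto
  qed
  then show ?thesis by (intro exI[of _ C] allI impI)
qed

section \<open>Polynomials graded by restriction to lines\<close>

definition homog :: "nat \<Rightarrow> (complex ^ 'd::finite \<Rightarrow> complex) \<Rightarrow> bool" where
  "homog k f \<longleftrightarrow> (\<exists>c. f = homog_part c k)"

lemma homogI: "(\<And>z. f z = homog_part c k z) \<Longrightarrow> homog k f"
  unfolding homog_def by (intro exI[of _ c] ext)

lemma homog_monomial: "homog (mi_size \<alpha>) (\<lambda>z. a * mi_power z \<alpha>)"
proof (rule homogI)
  fix z
  have "homog_part (\<lambda>\<beta>. if \<beta> = \<alpha> then a else 0) (mi_size \<alpha>) z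
      = (\<Sum>\<beta>\<in>degree_set (mi_size \<alpha>). if \<beta> = \<alpha> then a * mi_power z \<beta> else 0)"
    unfolding homog_part_def by (rule sum.cong) simp_all
  then show "a * mi_power z \<alpha> = homog_part (\<lambda>\<beta>. if \<beta> = \<alpha> then a else 0) (mi_size \<alpha>) z"
    by simp
qed

lemma homog_0: "homog k (\<lambda>z. 0)"
  by (rule homogI[of _ "\<lambda>_. 0"]) (simp add: homog_part_def)

lemma homog_add:
  assumes "homog k f" "homog k g"
  shows "homog k (\<lambda>z. f z + g z)"
proof -
  obtain c c' where c: "f = homog_part c k" "g = homog_part c' k" using assms unfolding homog_def by blast
  show ?thesis
    unfolding c by (rule homogI[of _ "\<lambda>\<alpha>. c \<alpha> + c' \<alpha>"]) (simp add: homog_part_def distrib_right sum.distrib)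
qed

lemma homog_sum: "finite A \<Longrightarrow> (\<And>x. x \<in> A \<Longrightarrow> homog k (P x)) \<Longrightarrow> homog k (\<lambda>z. \<Sum>x\<in>A. P x z)"
  by (induction A rule: finite_induct) (simp_all add: homog_0 homog_add)

lemma homog_mult:
  assumes "homog j f" "homog k g"
  shows "homog (j + k) (\<lambda>z. f z * g z)"
proof -
  obtain c c' where c: "f = homog_part c j" "g = homog_part c' k" using assms unfolding homog_def by blast
  have eq: "(\<lambda>z. f z * g z) = (\<lambda>z. \<Sum>\<alpha>\<in>degree_set j. \<Sum>\<beta>\<in>degree_set k. (c \<alpha> * c' \<beta>) * mi_power z (\<lambda>i. \<alpha> i + \<beta> i))"
    unfolding c homog_part_def sum_product mi_power_mult by (simp add: mult_ac)
  show ?thesis unfolding eq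
  proof (intro homog_sum finite_degree_set)
    fix \<alpha> \<beta> :: "'a \<Rightarrow> nat" assume "\<alpha> \<in> degree_set j" "\<beta> \<in> degree_set k"
    then have "mi_size (\<lambda>i. \<alpha> i + \<beta> i) = j + k" by (simp add: mi_size_def sum.distrib)
    then show "homog (j + k) (\<lambda>z. (c \<alpha> * c' \<beta>) * mi_power z (\<lambda>i. \<alpha> i + \<beta> i))"
      using homog_monomial[of "\<lambda>i. \<alpha> i + \<beta> i"] by metis
  qed
qed

lemma homog_const: "homog 0 (\<lambda>z. a)"
  using homog_monomial[of "\<lambda>_. 0" a] by (simp add: mi_power_def mi_size_def)

lemma homog_cmult: "homog k f \<Longrightarrow> homog k (\<lambda>z. a * f z)"
  using homog_mult[OF homog_const] by simp

text \<open>
  A graded family is a polynomial \<open>f\<close> of several variables, given by its restrictions \<open>\<lambda> \<mapsto> f (\<lambda> z)\<close> to the lines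
  through the origin; the value \<open>f z\<close> is recovered at \<open>\<lambda> = 1\<close>.
\<close>

definition graded :: "(complex ^ 'd::finite \<Rightarrow> complex poly) \<Rightarrow> bool" where
  "graded G \<longleftrightarrow> (\<forall>k. homog k (\<lambda>z. coeff (G z) k))"

lemma homog_convolution:
  assumes "\<And>k. homog k (F k)" "\<And>k. homog k (G k)"
  shows "homog k (\<lambda>z. \<Sum>i\<le>k. F i z * G (k - i) z)"
proof (intro homog_sum finite_atMost)
  fix i assume "i \<in> {..k}"
  then show "homog k (\<lambda>z. F i z * G (k - i) z)"
    using homog_mult[OF assms(1)[of i] assms(2)[of "k - i"]] by simp
qed

lemma graded_mult: "graded F \<Longrightarrow> graded G \<Longrightarrow> graded (\<lambda>z. F z * G z)"
  unfolding graded_def coeff_mult by (intro allI homog_convolution) simp_all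

lemma graded_power:
  assumes "graded F"
  shows "graded (\<lambda>z. F z ^ n)"
proof (induction n)
  case 0
  show ?case by (auto simp: graded_def homog_const homog_0)
qed (simp add: graded_mult assms)

text \<open>
  The coefficients of \<open>1 / P\<close> obey the recursion \<open>P\<^sub>0 H\<^sub>k = - (P\<^sub>1 H\<^sub>k\<^sub>-\<^sub>1 + \<dots> + P\<^sub>k H\<^sub>0)\<close>, which respects degrees because \<open>P\<^sub>0\<close>
  does not depend on \<open>z\<close>.
\<close>

lemma homog_fps_inverse:
  fixes P :: "complex ^ 'd::finite \<Rightarrow> complex poly"
  assumes P: "graded P" and c: "\<And>z. coeff (P z) 0 = c" "c \<noteq> 0"
  shows "homog k (\<lambda>z. fps_nth (inverse (fps_of_poly (P z))) k)"
proof (induction k rule: less_induct)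
  case (less k)
  let ?H = "\<lambda>k z. fps_nth (inverse (fps_of_poly (P z))) k"
  show ?case
  proof (cases "k = 0")
    case True
    then show ?thesis using c by (simp add: homog_const)
  next
    case False
    have rec: "?H k z = (- 1 / c) * (\<Sum>i\<in>{1..k}. coeff (P z) i * ?H (k - i) z)" for z
    proof -
      have "fps_of_poly (P z) * inverse (fps_of_poly (P z)) = 1"
        by (rule inverse_mult_eq_1') (use c in simp)
      then have "fps_nth (fps_of_poly (P z) * inverse (fps_of_poly (P z))) k = 0" using False by simp
      then have "(\<Sum>i=0..k. coeff (P z) i * ?H (k - i) z) = 0" by (simp add: fps_mult_nth)
      then have "c * ?H k z + (\<Sum>i\<in>{1..k}. coeff (P z) i * ?H (k - i) z) = 0"
        by (simp add: sum.atLeast_Suc_atMost c)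
      then have "c * ?H k z = - (\<Sum>i\<in>{1..k}. coeff (P z) i * ?H (k - i) z)"
        by (simp add: eq_neg_iff_add_eq_0)
      then show ?thesis using c(2) by (simp add: field_simps)
    qed
    show ?thesis unfolding rec
    proof (intro homog_cmult homog_sum finite_atLeastAtMost)
      fix i assume i: "i \<in> {1..k}"
      have "homog (i + (k - i)) (\<lambda>z. coeff (P z) i * ?H (k - i) z)"
        using P i by (intro homog_mult less) (auto simp: graded_def)
      then show "homog k (\<lambda>z. coeff (P z) i * ?H (k - i) z)" using i by simp
    qed
  qed
qed

lemma graded_inverse_poly:
  assumes "graded P" "\<And>z. coeff (P z) 0 = c" "c \<noteq> 0"
  shows "graded (\<lambda>z. inverse_poly r K (P z))"
  unfolding graded_def
proof
  fix k
  show "homog k (\<lambda>z. coeff (inverse_poly r K (P z)) k)"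
    using homog_cmult[OF homog_fps_inverse[OF assms], of k "of_real r ^ k"]
    by (cases "k \<le> K") (simp_all add: coeff_inverse_poly homog_0)
qed

lemma poly_1_eq_sum_coeff:
  fixes p :: "complex poly"
  assumes "degree p \<le> D"
  shows "poly p 1 = (\<Sum>k\<le>D. coeff p k)"
proof -
  have "poly p 1 = (\<Sum>k\<le>degree p. coeff p k)" by (simp add: poly_altdef)
  also have "\<dots> = (\<Sum>k\<le>D. coeff p k)"
    by (rule sum.mono_neutral_left) (use assms in \<open>auto intro: coeff_eq_0\<close>)
  finally show ?thesis .
qed

text \<open>
  The choice depends on \<open>\<alpha>\<close> only through its size, so that all coefficients of one degree stem from the same
  representation of the homogeneous part.
\<close>

definition coeffs_of :: "(complex ^ 'd::finite \<Rightarrow> complex poly) \<Rightarrow> ('d \<Rightarrow> nat) \<Rightarrow> complex" where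
  "coeffs_of G \<alpha> = (SOME c. (\<lambda>z. coeff (G z) (mi_size \<alpha>)) = homog_part c (mi_size \<alpha>)) \<alpha>"

lemma homog_part_coeffs_of:
  assumes "graded G"
  shows "homog_part (coeffs_of G) k z = coeff (G z) k"
proof -
  have "\<exists>c. (\<lambda>z. coeff (G z) k) = homog_part c k"
    using assms unfolding graded_def homog_def by blast
  then have "(\<lambda>z. coeff (G z) k) = homog_part (SOME c. (\<lambda>z. coeff (G z) k) = homog_part c k) k"
    by (rule someI_ex)
  moreover have "homog_part (coeffs_of G) k = homog_part (SOME c. (\<lambda>z. coeff (G z) k) = homog_part c k) k"
    unfolding homog_part_def coeffs_of_def by (intro ext sum.cong) auto
  ultimately show ?thesis by (metis (no_types, lifting))
qed

lemma coeffs_of_eq_0: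
  assumes "graded G" "\<And>z. degree (G z) \<le> D" "mi_size \<alpha> > D"
  shows "coeffs_of G \<alpha> = 0"
proof (rule coeff_eq_0_if_homog_part_eq_0)
  fix z show "homog_part (coeffs_of G) (mi_size \<alpha>) z = 0"
    unfolding homog_part_coeffs_of[OF assms(1)] by (rule coeff_eq_0) (use assms(2)[of z] assms(3) in simp)
qed

lemma graded_eval:
  assumes G: "graded G" and D: "\<And>z. degree (G z) \<le> D"
  shows "(\<lambda>z. poly (G z) 1) = (\<lambda>z. \<Sum>\<alpha>\<in>(\<Union>k\<le>D. degree_set k). coeffs_of G \<alpha> * mi_power z \<alpha>)"
proof
  fix z
  have "poly (G z) 1 = (\<Sum>k\<le>D. homog_part (coeffs_of G) k z)"
    unfolding homog_part_coeffs_of[OF G] by (rule poly_1_eq_sum_coeff[OF D])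
  also have "\<dots> = (\<Sum>\<alpha>\<in>(\<Union>k\<le>D. degree_set k). coeffs_of G \<alpha> * mi_power z \<alpha>)"
    unfolding homog_part_def by (rule sum.UNION_disjoint[symmetric]) auto
  finally show "poly (G z) 1 = (\<Sum>\<alpha>\<in>(\<Union>k\<le>D. degree_set k). coeffs_of G \<alpha> * mi_power z \<alpha>)" .
qed

lemma graded_polyfun:
  assumes "graded G" "\<And>z. degree (G z) \<le> D"
  shows "polyfun (\<lambda>z. poly (G z) 1)"
proof -
  have "finite (\<Union>k\<le>D. (degree_set k :: ('a \<Rightarrow> nat) set))" by simp
  then show ?thesis unfolding polyfun_def graded_eval[OF assms] by (intro exI conjI) (assumption, rule refl)
qed

lemma graded_power_series:
  assumes G: "graded G" and D: "\<And>z. degree (G z) \<le> D"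
  shows "has_power_series (\<lambda>z. poly (G z) 1) (coeffs_of G)"
proof -
  let ?A = "\<Union>k\<le>D. degree_set k"
  have "has_power_series (\<lambda>z. poly (G z) 1) (\<lambda>\<alpha>. if \<alpha> \<in> ?A then coeffs_of G \<alpha> else 0)"
    unfolding graded_eval[OF assms] by (rule has_power_series_polyfun) simp
  also have "(\<lambda>\<alpha>. if \<alpha> \<in> ?A then coeffs_of G \<alpha> else 0) = coeffs_of G"
    using coeffs_of_eq_0[OF assms] by (auto simp: fun_eq_iff)
  finally show ?thesis .
qed

lemma graded_sqnorm_le:
  fixes G :: "complex ^ 'd::finite \<Rightarrow> complex poly"
  assumes G: "graded G" and D: "\<And>z. degree (G z) \<le> D"
    and C: "\<And>z. norm z = 1 \<Longrightarrow> (\<Sum>k\<le>D. real (k + 1) ^ (CARD('d) - 1) * (cmod (coeff (G z) k))\<^sup>2) \<le> C"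
  shows "H2_sqnorm (\<lambda>z. poly (G z) 1) \<le> C"
proof -
  let ?A = "\<Union>k\<le>D. (degree_set k :: ('d \<Rightarrow> nat) set)"
  have "H2_sqnorm (\<lambda>z. poly (G z) 1) = (\<Sum>\<alpha>\<in>?A. H2_weight \<alpha> * (cmod (coeffs_of G \<alpha>))\<^sup>2)"
    by (rule finite_support_H2(2)[OF _ graded_power_series[OF G D]]) (use coeffs_of_eq_0[OF G D] in auto)
  also have "\<dots> = (\<Sum>k\<le>D. \<Sum>\<alpha>\<in>degree_set k. H2_weight \<alpha> * (cmod (coeffs_of G \<alpha>))\<^sup>2)"
    by (rule sum.UNION_disjoint) auto
  also have "\<dots> = (\<Sum>k\<le>D. \<Sum>\<alpha>\<in>degree_set k. real (mi_fact \<alpha>) / fact k * (cmod (coeffs_of G \<alpha>))\<^sup>2)"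
    by (intro sum.cong refl) (simp add: H2_weight_def)
  also have "\<dots> \<le> C"
    by (rule sphere_norm_bound) (simp only: homog_part_coeffs_of[OF G] C)
  finally show ?thesis .
qed

lemma graded_coeff_tendsto:
  assumes G: "\<And>j. graded (G j)" and G': "graded G'"
    and lim: "\<And>z k. (\<lambda>j. coeff (G j z) k) \<longlonglongrightarrow> coeff (G' z) k"
  shows "(\<lambda>j. coeffs_of (G j) \<alpha>) \<longlonglongrightarrow> coeffs_of G' \<alpha>"
  by (rule coeff_tendsto_if_homog_part_tendsto) (simp only: homog_part_coeffs_of[OF G] homog_part_coeffs_of[OF G'] lim)

section \<open>Bounded sequences that converge coefficientwise\<close>

text \<open>
  The elementary argument of Banach and Saks. If \<open>y - x\<^sub>j\<close> is bounded and tends to \<open>0\<close> coefficientwise, then it is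
  eventually almost orthogonal to any given polynomial. Hence one can add up suitable members so that the squared norm of a
  sum of \<open>M\<close> of them grows only linearly in \<open>M\<close>, and their mean is small.
\<close>

lemma banach_saks_polyfun:
  assumes V_add: "\<And>u v. u \<in> V \<Longrightarrow> v \<in> V \<Longrightarrow> (\<lambda>z. u z + v z) \<in> V" and V_0: "(\<lambda>z. 0) \<in> V"
    and V_scale: "\<And>u a. u \<in> V \<Longrightarrow> (\<lambda>z. a * u z) \<in> V"
    and V_poly: "\<And>u. u \<in> V \<Longrightarrow> polyfun u"
    and x: "\<And>j. x j \<in> V" and y: "polyfun y"
    and bound: "\<And>j. H2_sqnorm (\<lambda>z. y z - x j z) \<le> C"
    and lim: "\<And>\<alpha>. (\<lambda>j. taylor_coeff (\<lambda>z. y z - x j z) \<alpha>) \<longlonglongrightarrow> 0"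
    and \<epsilon>: "\<epsilon> > 0"
  shows "\<exists>v\<in>V. H2_sqnorm (\<lambda>z. y z - v z) < \<epsilon>"
proof -
  have poly_diff: "polyfun (\<lambda>z. a * y z - v z)" if "v \<in> V" for v a
    using polyfun_add[OF polyfun_mult[OF polyfun_const y] V_poly[OF V_scale[OF that, of "- 1"]], of a] by simp
  have step: "\<exists>v\<in>V. H2_sqnorm (\<lambda>z. of_nat M * y z - v z) \<le> real M * (C + 1)" for M
  proof (induction M)
    case 0
    have "has_power_series (\<lambda>z::complex^'a. 0) (\<lambda>_. 0)" by (simp add: has_power_series_def)
    from H2_term_eq[OF this] have "H2_sqnorm (\<lambda>z::complex^'a. 0) = 0" by (simp add: H2_sqnorm_def)
    then show ?case using V_0 by (intro bexI[of _ "\<lambda>z. 0"]) auto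
  next
    case (Suc M)
    then obtain v where v: "v \<in> V" and bd: "H2_sqnorm (\<lambda>z. of_nat M * y z - v z) \<le> real M * (C + 1)" by blast
    let ?u = "\<lambda>z. of_nat M * y z - v z"
    let ?w = "\<lambda>j z. y z - x j z"
    obtain A a where A: "finite A" "has_power_series ?u a" "\<And>\<alpha>. \<alpha> \<notin> A \<Longrightarrow> a \<alpha> = 0"
      using polyfun_power_series[OF poly_diff[OF v]] by blast
    \<comment> \<open>The mixed terms of the next summand live on the finite support of the sum built so far.\<close>
    have "(\<lambda>j. \<Sum>\<alpha>\<in>A. H2_weight \<alpha> * (2 * cmod (a \<alpha>) * cmod (taylor_coeff (?w j) \<alpha>)))
        \<longlonglongrightarrow> (\<Sum>\<alpha>\<in>A. H2_weight \<alpha> * (2 * cmod (a \<alpha>) * cmod 0))"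
      by (intro tendsto_intros lim)
    then have "\<forall>\<^sub>F j in sequentially. (\<Sum>\<alpha>\<in>A. H2_weight \<alpha> * (2 * cmod (a \<alpha>) * cmod (taylor_coeff (?w j) \<alpha>))) < 1"
      by (rule order_tendstoD) simp
    then obtain j where j: "(\<Sum>\<alpha>\<in>A. H2_weight \<alpha> * (2 * cmod (a \<alpha>) * cmod (taylor_coeff (?w j) \<alpha>))) < 1"
      by (meson eventually_happens sequentially_bot)
    obtain B b where B: "finite B" "has_power_series (?w j) b" "\<And>\<alpha>. \<alpha> \<notin> B \<Longrightarrow> b \<alpha> = 0"
      using polyfun_power_series[OF poly_diff[OF x[of j], of 1]] by auto
    have b: "taylor_coeff (?w j) = b" by (rule taylor_coeff_eq[OF B(2)])
    let ?AB = "A \<union> B"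
    have nAB: "H2_sqnorm (\<lambda>z. ?u z + ?w j z) = (\<Sum>\<alpha>\<in>?AB. H2_weight \<alpha> * (cmod (a \<alpha> + b \<alpha>))\<^sup>2)"
      by (rule finite_support_H2(2)[OF _ has_power_series_add[OF A(2) B(2)]]) (use A B in auto)
    have nA: "H2_sqnorm ?u = (\<Sum>\<alpha>\<in>?AB. H2_weight \<alpha> * (cmod (a \<alpha>))\<^sup>2)"
      by (rule finite_support_H2(2)[OF _ A(2)]) (use A B in auto)
    have nB: "H2_sqnorm (?w j) = (\<Sum>\<alpha>\<in>?AB. H2_weight \<alpha> * (cmod (b \<alpha>))\<^sup>2)"
      by (rule finite_support_H2(2)[OF _ B(2)]) (use A B in auto)
    have cross: "(\<Sum>\<alpha>\<in>?AB. H2_weight \<alpha> * (2 * cmod (a \<alpha>) * cmod (b \<alpha>))) = (\<Sum>\<alpha>\<in>A. H2_weight \<alpha> * (2 * cmod (a \<alpha>) * cmod (b \<alpha>)))"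
      by (rule sum.mono_neutral_right) (use A B in auto)
    have "H2_sqnorm (\<lambda>z. ?u z + ?w j z)
      \<le> (\<Sum>\<alpha>\<in>?AB. H2_weight \<alpha> * ((cmod (a \<alpha>))\<^sup>2 + (cmod (b \<alpha>))\<^sup>2 + 2 * cmod (a \<alpha>) * cmod (b \<alpha>)))"
      unfolding nAB
    proof (intro sum_mono mult_left_mono H2_weight_nonneg)
      fix \<alpha>
      have "(cmod (a \<alpha> + b \<alpha>))\<^sup>2 \<le> (cmod (a \<alpha>) + cmod (b \<alpha>))\<^sup>2" by (intro power_mono norm_triangle_ineq) auto
      then show "(cmod (a \<alpha> + b \<alpha>))\<^sup>2 \<le> (cmod (a \<alpha>))\<^sup>2 + (cmod (b \<alpha>))\<^sup>2 + 2 * cmod (a \<alpha>) * cmod (b \<alpha>)"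
        by (simp add: power2_sum)
    qed
    also have "\<dots> = H2_sqnorm ?u + H2_sqnorm (?w j) + (\<Sum>\<alpha>\<in>A. H2_weight \<alpha> * (2 * cmod (a \<alpha>) * cmod (b \<alpha>)))"
      unfolding nA nB cross[symmetric] distrib_left sum.distrib ..
    also have "\<dots> \<le> real M * (C + 1) + C + 1"
      using bd bound[of j] j unfolding b by linarith
    finally have "H2_sqnorm (\<lambda>z. ?u z + ?w j z) \<le> real (Suc M) * (C + 1)" by (simp add: algebra_simps)
    moreover have "(\<lambda>z. ?u z + ?w j z) = (\<lambda>z. of_nat (Suc M) * y z - (v z + x j z))"
      by (simp add: fun_eq_iff algebra_simps)
    ultimately show ?case using V_add[OF v x[of j]] by (intro bexI[of _ "\<lambda>z. v z + x j z"]) simp_all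
  qed
  obtain M :: nat where M: "real M > \<bar>C + 1\<bar> / \<epsilon>" using reals_Archimedean2 by blast
  have Mpos: "M > 0" using M \<epsilon> by (intro gr0I) (simp add: divide_less_0_iff)
  obtain v where v: "v \<in> V" and bd: "H2_sqnorm (\<lambda>z. of_nat M * y z - v z) \<le> real M * (C + 1)" using step by blast
  have "(\<lambda>z. y z - (1 / of_nat M) * v z) = (\<lambda>z. (1 / of_nat M) * (of_nat M * y z - v z))"
    using Mpos by (simp add: fun_eq_iff field_simps)
  then have "H2_sqnorm (\<lambda>z. y z - (1 / of_nat M) * v z) = (1 / real M)\<^sup>2 * H2_sqnorm (\<lambda>z. of_nat M * y z - v z)"
    using H2_cmult(2)[OF polyfun_H2[OF poly_diff[OF v]], of "1 / of_nat M"] by (simp add: norm_divide)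
  also have "\<dots> \<le> (1 / real M)\<^sup>2 * (real M * (C + 1))" by (intro mult_left_mono bd) auto
  also have "\<dots> = (C + 1) / real M" using Mpos by (simp add: power2_eq_square)
  also have "\<dots> < \<epsilon>" using M \<epsilon> Mpos by (simp add: field_simps) 
  finally show ?thesis by (rule bexI[OF _ V_scale[OF v]])
qed

section \<open>Stable polynomials and cyclic subspaces\<close>

definition slice :: "(('d::finite \<Rightarrow> nat) \<Rightarrow> complex) \<Rightarrow> ('d \<Rightarrow> nat) set \<Rightarrow> complex ^ 'd \<Rightarrow> complex poly" where
  "slice c A z = (\<Sum>\<alpha>\<in>A. monom (c \<alpha> * mi_power z \<alpha>) (mi_size \<alpha>))"

lemma poly_slice: "poly (slice c A z) x = (\<Sum>\<alpha>\<in>A. c \<alpha> * mi_power (x *s z) \<alpha>)"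
  by (simp add: slice_def poly_sum poly_monom mi_power_scale mult_ac)

lemma graded_slice: "finite A \<Longrightarrow> graded (slice c A)"
  unfolding graded_def slice_def coeff_sum coeff_monom
proof (intro allI homog_sum)
  fix k \<alpha>
  show "homog k (\<lambda>z. if mi_size \<alpha> = k then c \<alpha> * mi_power z \<alpha> else 0)"
    by (cases "mi_size \<alpha> = k") (auto simp: homog_0 intro: homog_monomial)
qed

lemma degree_slice_le: "finite A \<Longrightarrow> degree (slice c A z) \<le> (\<Sum>\<alpha>\<in>A. mi_size \<alpha>)"
  unfolding slice_def
  by (intro degree_sum_le order.trans[OF degree_monom_le] member_le_sum) auto

text \<open>
  The approximants are \<open>Q\<^sub>j p\<^sup>n\<^sup>+\<^sup>1\<close>, where \<open>Q\<^sub>j\<close> is the Taylor polynomial of degree \<open>K\<^sub>j\<close> of \<open>1 / p(r\<^sub>j z)\<close> with \<open>r\<^sub>j \<rightarrow> 1\<close>. The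
  degree \<open>K\<^sub>j\<close> is chosen after \<open>r\<^sub>j\<close> so that the norms stay bounded, and \<open>K\<^sub>j \<ge> j\<close> ensures that the coefficients converge to those
  of \<open>p\<^sup>n\<^sup>+\<^sup>1 / p = p\<^sup>n\<close>.
\<close>

lemma stable_power_approx:
  fixes p :: "complex ^ 'd::finite \<Rightarrow> complex"
  assumes p: "p \<in> stable_polys" and n: "CARD('d) \<le> 2 * n + 2" and \<epsilon>: "\<epsilon> > 0"
  shows "\<exists>Q. polyfun Q \<and> H2_sqnorm (\<lambda>z. p z ^ n - Q z * p z ^ (n + 1)) < \<epsilon>"
proof -
  obtain A c where A: "finite A" and p_eq: "p = (\<lambda>z. \<Sum>\<alpha>\<in>A. c \<alpha> * mi_power z \<alpha>)"
    and p_nz: "\<And>z. z \<in> ball 0 1 \<Longrightarrow> p z \<noteq> 0"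
    using CollectD[OF p[unfolded stable_polys_def]] by (elim conjE exE) simp
  have polyp: "polyfun p" unfolding polyfun_def by (intro exI conjI) (rule A, rule p_eq)
  define P where "P = slice c A"
  define m where "m = (\<Sum>\<alpha>\<in>A. mi_size \<alpha>)"
  define s where "s = CARD('d) - 1"
  have s: "s \<le> 2 * n + 1" using n by (simp add: s_def)
  have polyP: "poly (P z) x = p (x *s z)" for z x by (simp add: P_def poly_slice p_eq)
  have P1: "poly (P z) 1 = p z" for z by (simp add: polyP)
  have P0: "poly (P z) 0 = p 0" for z by (simp add: polyP)
  have coeff0: "coeff (P z) 0 = p 0" for z using P0 by (simp add: poly_0_coeff_0)
  have p0: "p 0 \<noteq> 0" by (rule p_nz) simp
  have gP: "graded P" unfolding P_def by (rule graded_slice[OF A])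
  have degP: "degree (P z) \<le> m" for z unfolding P_def m_def by (rule degree_slice_le[OF A])
  have stab: "disc_stable m (p 0) (P z)" if "norm z = 1" for z
    unfolding disc_stable_def using that by (auto simp: degP P0 polyP norm_vector_scale intro!: p_nz)
  from truncated_quotient_bound[OF s, of m "p 0"]
  obtain C where C: "\<forall>r N. 0 \<le> r \<longrightarrow> r < 1 \<longrightarrow> (\<exists>K\<ge>N. \<forall>P. disc_stable m (p 0) P \<longrightarrow>
    (\<Sum>k\<le>K + m * (n + 1). real (k + 1) ^ s * (cmod (coeff (inverse_poly r K P * P ^ (n + 1)) k))\<^sup>2) \<le> C)" ..
  define r where "r j = real j / real (j + 1)" for j
  have r: "0 \<le> r j" "r j < 1" for j by (auto simp: r_def)
  have r_lim: "r \<longlonglongrightarrow> 1" unfolding r_def by real_asymp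
  have "\<forall>j. \<exists>K. K \<ge> j \<and> (\<forall>P. disc_stable m (p 0) P \<longrightarrow>
    (\<Sum>k\<le>K + m * (n + 1). real (k + 1) ^ s * (cmod (coeff (inverse_poly (r j) K P * P ^ (n + 1)) k))\<^sup>2) \<le> C)"
    by (intro allI, rule C[rule_format, OF r])
  from choice[OF this] obtain K where KK: "\<forall>j. K j \<ge> j \<and> (\<forall>P. disc_stable m (p 0) P \<longrightarrow>
    (\<Sum>k\<le>K j + m * (n + 1). real (k + 1) ^ s * (cmod (coeff (inverse_poly (r j) (K j) P * P ^ (n + 1)) k))\<^sup>2) \<le> C)" ..
  have K: "K j \<ge> j" for j using KK by blast
  have Kb: "(\<Sum>k\<le>K j + m * (n + 1). real (k + 1) ^ s * (cmod (coeff (inverse_poly (r j) (K j) P * P ^ (n + 1)) k))\<^sup>2) \<le> C"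
    if "disc_stable m (p 0) P" for j P
    by (rule KK[rule_format, THEN conjunct2, rule_format, OF that])
  define Q where "Q j z = inverse_poly (r j) (K j) (P z)" for j z
  define G where "G j z = Q j z * P z ^ (n + 1)" for j z
  have gQ: "graded (Q j)" for j
    unfolding Q_def by (rule graded_inverse_poly[OF gP coeff0 p0])
  have gG: "graded (G j)" for j
    unfolding G_def by (intro graded_mult graded_power gQ gP)
  have degQ: "degree (Q j z) \<le> K j" for j z
    unfolding Q_def by (rule degree_le) (simp add: coeff_inverse_poly)
  have degPn: "degree (P z ^ k) \<le> m * k" for z k
    using degree_power_le[of "P z" k] mult_le_mono1[OF degP[of z], of k] by linarith
  have degG: "degree (G j z) \<le> K j + m * (n + 1)" for j z
    unfolding G_def using degree_mult_le[of "Q j z" "P z ^ (n + 1)"] degQ[of j z] degPn[of z "n + 1"] by linarith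
  have G1: "poly (G j z) 1 = poly (Q j z) 1 * p z ^ (n + 1)" for j z
    by (simp only: G_def poly_mult poly_power P1)
  have polyQ: "polyfun (\<lambda>z. poly (Q j z) 1)" for j by (rule graded_polyfun[OF gQ degQ])
  have normG: "H2_sqnorm (\<lambda>z. poly (G j z) 1) \<le> C" for j
    by (rule graded_sqnorm_le[OF gG degG]) (unfold G_def Q_def s_def[symmetric], rule Kb[OF stab])
  have gPn: "graded (\<lambda>z. P z ^ n)" by (rule graded_power[OF gP])
  have Pn_series: "has_power_series (\<lambda>z. p z ^ n) (coeffs_of (\<lambda>z. P z ^ n))"
    using graded_power_series[OF gPn degPn] by (simp only: poly_power P1)
  have lim: "(\<lambda>j. coeffs_of (G j) \<alpha>) \<longlonglongrightarrow> coeffs_of (\<lambda>z. P z ^ n) \<alpha>" for \<alpha>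
  proof (rule graded_coeff_tendsto[OF gG gPn])
    fix z k
    let ?H = "inverse (fps_of_poly (P z))" and ?F = "fps_of_poly (P z ^ (n + 1))"
    have "(\<lambda>j. fps_nth (fps_dilate (r j) ?H * ?F) k) \<longlonglongrightarrow> (\<Sum>i=0..k. of_real 1 ^ i * fps_nth ?H i * fps_nth ?F (k - i))"
      unfolding fps_mult_nth fps_dilate_def fps_nth_Abs_fps by (intro tendsto_intros r_lim)
    also have "(\<Sum>i=0..k. of_real 1 ^ i * fps_nth ?H i * fps_nth ?F (k - i)) = fps_nth (?H * ?F) k"
      by (simp add: fps_mult_nth)
    also have "?H * ?F = (?H * fps_of_poly (P z)) * fps_of_poly (P z ^ n)"
      by (simp add: fps_of_poly_mult mult.assoc)
    also have "?H * fps_of_poly (P z) = 1"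
      by (rule inverse_mult_eq_1) (simp add: coeff0 p0)
    finally have "(\<lambda>j. fps_nth (fps_dilate (r j) ?H * ?F) k) \<longlonglongrightarrow> coeff (P z ^ n) k" by simp
    moreover have "\<forall>\<^sub>F j in sequentially. fps_nth (fps_dilate (r j) ?H * ?F) k = coeff (G j z) k"
      using eventually_ge_at_top[of k]
    proof eventually_elim
      case (elim j)
      then have "k \<le> K j" using K[of j] by linarith
      then show ?case unfolding G_def Q_def by (rule coeff_inverse_poly_mult_low[symmetric])
    qed
    ultimately show "(\<lambda>j. coeff (G j z) k) \<longlonglongrightarrow> coeff (P z ^ n) k"
      by (rule Lim_transform_eventually)
  qed
  define V where "V = (\<lambda>R z. R z * p z ^ (n + 1)) ` Collect polyfun"
  have V_I: "(\<lambda>z. R z * p z ^ (n + 1)) \<in> V" if "polyfun R" for R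
    unfolding V_def by (rule image_eqI[OF refl]) (simp add: that)
  have V_E: "\<exists>R. polyfun R \<and> u = (\<lambda>z. R z * p z ^ (n + 1))" if "u \<in> V" for u
    using that unfolding V_def image_iff by simp
  have pn: "polyfun (\<lambda>z. p z ^ n)" by (rule polyfun_power[OF polyp])
  have "\<exists>v\<in>V. H2_sqnorm (\<lambda>z. p z ^ n - v z) < \<epsilon>"
  proof (rule banach_saks_polyfun)
    fix u v assume "u \<in> V" "v \<in> V"
    from V_E[OF this(1)] V_E[OF this(2)] obtain R S
      where R: "polyfun R" "u = (\<lambda>z. R z * p z ^ (n + 1))" and S: "polyfun S" "v = (\<lambda>z. S z * p z ^ (n + 1))"
      by (elim exE conjE)
    show "(\<lambda>z. u z + v z) \<in> V"
      unfolding R(2) S(2) distrib_right[symmetric] by (rule V_I[OF polyfun_add[OF R(1) S(1)]])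
  next
    show "(\<lambda>z. 0) \<in> V" using V_I[OF polyfun_0] by simp
  next
    fix u a assume "u \<in> V"
    from V_E[OF this] obtain R where R: "polyfun R" "u = (\<lambda>z. R z * p z ^ (n + 1))" by (elim exE conjE)
    show "(\<lambda>z. a * u z) \<in> V"
      unfolding R(2) mult.assoc[symmetric] by (rule V_I[OF polyfun_mult[OF polyfun_const R(1)]])
  next
    fix u assume "u \<in> V"
    from V_E[OF this] obtain R where R: "polyfun R" "u = (\<lambda>z. R z * p z ^ (n + 1))" by (elim exE conjE)
    show "polyfun u" unfolding R(2) by (rule polyfun_mult[OF R(1) polyfun_power[OF polyp]])
  next
    fix j
    show "(\<lambda>z. poly (G j z) 1) \<in> V" unfolding G1 by (rule V_I[OF polyQ])
  next
    fix j
    have "H2_sqnorm (\<lambda>z. p z ^ n - poly (G j z) 1) \<le> 2 * H2_sqnorm (\<lambda>z. p z ^ n) + 2 * H2_sqnorm (\<lambda>z. poly (G j z) 1)"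
      by (intro H2_diff polyfun_H2 pn graded_polyfun[OF gG degG])
    then show "H2_sqnorm (\<lambda>z. p z ^ n - poly (G j z) 1) \<le> 2 * H2_sqnorm (\<lambda>z. p z ^ n) + 2 * C"
      using normG[of j] by linarith
  next
    fix \<alpha>
    have ser: "has_power_series (\<lambda>z. p z ^ n - poly (G j z) 1) (\<lambda>\<alpha>. coeffs_of (\<lambda>z. P z ^ n) \<alpha> + (- 1) * coeffs_of (G j) \<alpha>)" for j
      using has_power_series_add[OF Pn_series has_power_series_cmult[OF graded_power_series[OF gG degG], of "- 1"]] by simp
    have "(\<lambda>j. coeffs_of (\<lambda>z. P z ^ n) \<alpha> + (- 1) * coeffs_of (G j) \<alpha>) \<longlonglongrightarrow> coeffs_of (\<lambda>z. P z ^ n) \<alpha> + (- 1) * coeffs_of (\<lambda>z. P z ^ n) \<alpha>"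
      by (intro tendsto_intros lim)
    then show "(\<lambda>j. taylor_coeff (\<lambda>z. p z ^ n - poly (G j z) 1) \<alpha>) \<longlonglongrightarrow> 0"
      unfolding taylor_coeff_eq[OF ser] by simp
  qed (rule pn, rule \<epsilon>)
  then obtain v where v: "v \<in> V" "H2_sqnorm (\<lambda>z. p z ^ n - v z) < \<epsilon>" ..
  from V_E[OF v(1)] obtain R where R: "polyfun R" "v = (\<lambda>z. R z * p z ^ (n + 1))" by (elim exE conjE)
  show ?thesis by (rule exI[of _ R]) (use R v(2) in simp)
qed

text \<open>
  For \<open>\<phi> p\<^sup>n\<close> with a multiplier \<open>\<phi>\<close> it would not do to multiply the approximation of \<open>p\<^sup>n\<close> by \<open>\<phi>\<close>, as the definition of a
  multiplier contains no norm bound. Instead \<open>\<phi>\<close>, as an element of \<open>H\<^sup>2\<close>, is first replaced by a polynomial \<open>R\<close> that is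
  close in norm; multiplication by \<open>p\<^sup>n\<close> and by \<open>R\<close> is bounded.
\<close>

lemma cyclic_subspace_power_eq:
  fixes p :: "complex ^ 'd::finite \<Rightarrow> complex"
  assumes polyp: "polyfun p"
    and approx: "\<And>\<epsilon>. \<epsilon> > 0 \<Longrightarrow> \<exists>Q. polyfun Q \<and> H2_sqnorm (\<lambda>z. p z ^ n - Q z * p z ^ (n + 1)) < \<epsilon>"
  shows "cyclic_subspace (\<lambda>z. p z ^ n) = cyclic_subspace (\<lambda>z. p z ^ (n + 1))"
proof
  show "cyclic_subspace (\<lambda>z. p z ^ (n + 1)) \<subseteq> cyclic_subspace (\<lambda>z. p z ^ n)"
  proof
    fix g assume g: "g \<in> cyclic_subspace (\<lambda>z. p z ^ (n + 1))"
    show "g \<in> cyclic_subspace (\<lambda>z. p z ^ n)"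
      unfolding in_cyclic_subspace_iff
    proof (intro conjI allI impI)
      show "g \<in> H2" using g by (simp add: in_cyclic_subspace_iff)
      fix \<epsilon> :: real assume "\<epsilon> > 0"
      then obtain \<phi> where \<phi>: "\<phi> \<in> Mult_H2" "H2_norm (\<lambda>z. g z - \<phi> z * p z ^ (n + 1)) < \<epsilon>"
        using g unfolding in_cyclic_subspace_iff by (elim conjE allE impE bexE)
      have "(\<lambda>z. \<phi> z * p z) \<in> Mult_H2"
        unfolding Mult_H2_def
      proof (intro CollectI ballI)
        fix f :: "complex ^ 'd \<Rightarrow> complex" assume "f \<in> H2"
        then have "(\<lambda>z. p z * f z) \<in> H2" by (rule bounded_mult_H2[OF polyfun_bounded_mult[OF polyp]])
        then show "(\<lambda>z. \<phi> z * p z * f z) \<in> H2" unfolding mult.assoc by (rule Mult_H2D[OF \<phi>(1)])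
      qed
      moreover have "H2_norm (\<lambda>z. g z - \<phi> z * p z * p z ^ n) < \<epsilon>"
        using \<phi>(2) by (simp add: mult.assoc)
      ultimately show "\<exists>\<psi>\<in>Mult_H2. H2_norm (\<lambda>z. g z - \<psi> z * p z ^ n) < \<epsilon>"
        by (intro bexI[of _ "\<lambda>z. \<phi> z * p z"])
    qed
  qed
next
  show "cyclic_subspace (\<lambda>z. p z ^ n) \<subseteq> cyclic_subspace (\<lambda>z. p z ^ (n + 1))"
  proof
    fix g assume "g \<in> cyclic_subspace (\<lambda>z. p z ^ n)"
    then have g: "g \<in> H2" and g_approx: "\<And>\<epsilon>. \<epsilon> > 0 \<Longrightarrow> \<exists>\<phi>\<in>Mult_H2. H2_norm (\<lambda>z. g z - \<phi> z * p z ^ n) < \<epsilon>"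
      by (simp_all add: in_cyclic_subspace_iff)
    show "g \<in> cyclic_subspace (\<lambda>z. p z ^ (n + 1))"
      unfolding in_cyclic_subspace_iff
    proof (intro conjI allI impI)
      show "g \<in> H2" by (rule g)
      fix \<epsilon> :: real assume \<epsilon>: "\<epsilon> > 0"
      \<comment> \<open>The three errors below enter with the factors 2, 4 and 4.\<close>
      define \<delta> where "\<delta> = \<epsilon>\<^sup>2 / 12"
      have \<delta>: "\<delta> > 0" using \<epsilon> by (simp add: \<delta>_def)
      obtain \<phi> where \<phi>: "\<phi> \<in> Mult_H2" and 1: "H2_norm (\<lambda>z. g z - \<phi> z * p z ^ n) < sqrt \<delta>"
        using g_approx[OF real_sqrt_gt_zero[OF \<delta>]] by (elim bexE)
      have 1: "H2_sqnorm (\<lambda>z. g z - \<phi> z * p z ^ n) < \<delta>"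
        using 1 \<delta> unfolding H2_norm_less_iff[OF real_sqrt_gt_zero[OF \<delta>]] by simp
      have pn: "polyfun (\<lambda>z. p z ^ n)" and pn1: "polyfun (\<lambda>z. p z ^ (n + 1))"
        by (rule polyfun_power[OF polyp])+
      have "(\<lambda>z. \<phi> z * 1) \<in> H2"
        by (rule Mult_H2D[OF \<phi> polyfun_H2[OF polyfun_const[of 1]]])
      then have \<phi>H: "\<phi> \<in> H2" by simp
      obtain B where B: "B > 0" "mult_bound B (\<lambda>z. p z ^ n)"
        using polyfun_bounded_mult[OF pn] by (rule bounded_multE)
      have "\<delta> / (2 * B) > 0" using \<delta> B(1) by simp
      from polyfun_dense[OF \<phi>H this]
      obtain R where R: "polyfun R" and R_le: "H2_sqnorm (\<lambda>z. \<phi> z - R z) \<le> \<delta> / (2 * B)"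
        by (elim exE conjE)
      have d: "(\<lambda>z. \<phi> z - R z) \<in> H2" by (rule H2_diff(1)[OF \<phi>H polyfun_H2[OF R]])
      have "H2_sqnorm (\<lambda>z. p z ^ n * (\<phi> z - R z)) \<le> B * (\<delta> / (2 * B))"
        using mult_bound_sqnorm[OF B(2) d] mult_left_mono[OF R_le, of B] B(1) by linarith
      then have 2: "H2_sqnorm (\<lambda>z. p z ^ n * (\<phi> z - R z)) < \<delta>" using B(1) \<delta> by simp
      have H2: "(\<lambda>z. p z ^ n * (\<phi> z - R z)) \<in> H2" by (rule mult_bound_H2[OF B(2) d])
      obtain B' where B': "B' > 0" "mult_bound B' R"
        using polyfun_bounded_mult[OF R] by (rule bounded_multE)
      have "\<delta> / B' > 0" using \<delta> B'(1) by simp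
      from approx[OF this]
      obtain Q where Q: "polyfun Q" and Q_less: "H2_sqnorm (\<lambda>z. p z ^ n - Q z * p z ^ (n + 1)) < \<delta> / B'"
        by (elim exE conjE)
      have e: "(\<lambda>z. p z ^ n - Q z * p z ^ (n + 1)) \<in> H2"
        by (rule H2_diff(1)[OF polyfun_H2[OF pn] polyfun_H2[OF polyfun_mult[OF Q pn1]]])
      have "H2_sqnorm (\<lambda>z. R z * (p z ^ n - Q z * p z ^ (n + 1))) < B' * (\<delta> / B')"
        using mult_bound_sqnorm[OF B'(2) e] mult_strict_left_mono[OF Q_less, of B'] B'(1) by linarith
      then have 3: "H2_sqnorm (\<lambda>z. R z * (p z ^ n - Q z * p z ^ (n + 1))) < \<delta>" using B'(1) by simp
      have H3: "(\<lambda>z. R z * (p z ^ n - Q z * p z ^ (n + 1))) \<in> H2" by (rule mult_bound_H2[OF B'(2) e])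
      have "(\<lambda>z. \<phi> z * p z ^ n) \<in> H2" by (rule Mult_H2D[OF \<phi> polyfun_H2[OF pn]])
      then have H1: "(\<lambda>z. g z - \<phi> z * p z ^ n) \<in> H2" by (rule H2_diff(1)[OF g])
      have "(\<lambda>z. g z - (R z * Q z) * p z ^ (n + 1))
          = (\<lambda>z. (g z - \<phi> z * p z ^ n) + (p z ^ n * (\<phi> z - R z) + R z * (p z ^ n - Q z * p z ^ (n + 1))))"
        by (simp add: fun_eq_iff algebra_simps)
      then have "H2_sqnorm (\<lambda>z. g z - (R z * Q z) * p z ^ (n + 1)) \<le> 2 * \<delta> + 2 * (2 * \<delta> + 2 * \<delta>)"
        using H2_add(2)[OF H1 H2_add(1)[OF H2 H3]] H2_add(2)[OF H2 H3] 1 2 3 by simp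
      also have "\<dots> < \<epsilon>\<^sup>2" using \<epsilon> by (simp add: \<delta>_def)
      finally have "H2_norm (\<lambda>z. g z - (R z * Q z) * p z ^ (n + 1)) < \<epsilon>"
        by (simp only: H2_norm_less_iff[OF \<epsilon>])
      moreover have "(\<lambda>z. R z * Q z) \<in> Mult_H2"
        by (rule bounded_mult_imp_Mult[OF polyfun_bounded_mult[OF polyfun_mult[OF R Q]]])
      ultimately show "\<exists>\<psi>\<in>Mult_H2. H2_norm (\<lambda>z. g z - \<psi> z * p z ^ (n + 1)) < \<epsilon>"
        by (intro bexI[of _ "\<lambda>z. R z * Q z"])
    qed
  qed
qed

lemma stable_polys_subset_C_class:
  assumes "CARD('d::finite) \<le> 2 * n + 2"
  shows "(stable_polys :: (complex ^ 'd \<Rightarrow> complex) set) \<subseteq> C_class n"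
proof
  fix p :: "complex ^ 'd \<Rightarrow> complex" assume p: "p \<in> stable_polys"
  then have polyp: "polyfun p" unfolding stable_polys_def polyfun_def by blast
  have "p 0 \<noteq> 0" using p unfolding stable_polys_def by simp
  then have nz: "\<exists>z\<in>ball 0 1. p z \<noteq> 0" by (intro bexI[of _ 0]) simp_all
  have "cyclic_subspace (\<lambda>z. p z ^ n) = cyclic_subspace (\<lambda>z. p z ^ (n + 1))"
    by (rule cyclic_subspace_power_eq[OF polyp stable_power_approx[OF p assms]])
  then show "p \<in> C_class n"
    unfolding C_class_def using nz bounded_mult_imp_Mult[OF polyfun_bounded_mult[OF polyp]] by simp
qed

theorem mainTheorem7:
  "(odd CARD('d::finite) \<longrightarrow>
      (stable_polys :: (complex ^ 'd \<Rightarrow> complex) set) \<subseteq> C_class ((CARD('d) - 1) div 2)) \<and>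
   (even CARD('d) \<longrightarrow>
      (stable_polys :: (complex ^ 'd \<Rightarrow> complex) set) \<subseteq> C_class (CARD('d) div 2 - 1))"
proof (intro conjI impI stable_polys_subset_C_class)
  have d: "CARD('d) > 0" by simp
  show "CARD('d) \<le> 2 * ((CARD('d) - 1) div 2) + 2" by linarith
  show "CARD('d) \<le> 2 * (CARD('d) div 2 - 1) + 2" if "even CARD('d)" using that d by (auto elim!: evenE)
qed

end
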